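(* Let $G=(V,E)$ be a finite directed graph with $|V|=K$, with node-to-node activation rates $\alpha_{ij}$, self-activation rates $\beta_i$, recovery rates $\gamma_i$ and initially activated (source) set $S\subset V$, and consider the associated continuous-time propagation process on $G$. Let $N(t)$ be the number of activated nodes at time $t$. For every $k=0,1,\dots,K$ let $\mathcal{S}_k:=\{U\subset V:|U|=k\}$. For $U\in\mathcal{S}_k$ let $\mathrm{Pr}(t;U)$ be the probability that, among the sets in $\mathcal{S}_k$, $U$ is the activated set at time $t$, and define $$\alpha(U)=\sum_{i\in U}\ \sum_{j\in N_i^{\mathrm{out}}\cap U^c}\alpha_{ij},\qquad \beta(U)=\sum_{i\in U}\beta_i,\qquad \gamma(U)=\sum_{i\in U}\gamma_i ,$$ where $U^c=V\setminus U$. Then the transition rates $q_k(t)$ (from $N=k$ to $N=k+1$) and $r_k(t)$ (from $N=k$ to $N=k-1$) of $N(t)$, which are the coefficients in the system of differential equations $$\rho_0'(t)=-q_0(t)\rho_0(t)+r_1(t)\rho_1(t),$$ $$\rho_k'(t)=q_{k-1}(t)\rho_{k-1}(t)-[q_k(t)+r_k(t)]\rho_k(t)+r_{k+1}(t)\rho_{k+1}(t),\quad 0<k<K,$$ $$\rho_K'(t)=q_{K-1}(t)\rho_{K-1}(t)-r_K(t)\rho_K(t)$$ governing $\rho_k(t)=\mathrm{Pr}(N(t)=k)$, are given by $$q_k(t)=\sum_{U\in\mathcal{S}_k}\left[\alpha(U)+\beta(U^c)\right]\mathrm{Pr}(t;U)\qquad\text{and}\qquad r_k(t)=\sum_{U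\in\mathcal{S}_k}\gamma(U)\,\mathrm{Pr}(t;U).$$
   Context: Propagation process: at each time every node of $V$ is either active or inactive; at time $0$ exactly the nodes of $S$ are active. $N_i^{\mathrm{out}}=\{j:(i,j)\in E\}$. Once node $i$ is active, the time it takes to activate an inactive $j\in N_i^{\mathrm{out}}$ is exponentially distributed with rate $\alpha_{ij}>0$ (density $\alpha_{ij}e^{-\alpha_{ij}\tau}$, $\tau\ge 0$); by convention $\alpha_{ij}=0$ if $(i,j)\notin E$. An inactive node $i$ becomes active by itself after an exponential time of rate $\beta_i\geq 0$ ($\beta_i=0$: no self-activation), and an active node $i$ recovers (becomes inactive, and can be activated again) after an exponential time of rate $\gamma_i\ge 0$ ($\gamma_i=0$: no recovery). All these times are independent. Thus the set of active nodes is a time-homogeneous continuous-time Markov chain on the subsets of $V$. "$U$ is activated at time $t$" means that all nodes of $U$ are active and all nodes of $U^c=V\setminus U$ are inactive at time $t$. $\mathrm{Pr}(t;U)$ for $U\in\mathcal{S}_k$ is the conditional probability that $U$ is activated at time $t$ given $N(t)=k$; so $\sum_{U\in\mathcal{S}_k}\mathrm{Pr}(t;U)=1$. It is defined when $\mathrm{Pr}(N(t)=k)>0$. The transition rate $q_k(t)$ is the instantaneous rate at which $N$ goes from $k$ to $k+1$ at time $t$, i.e. $q_k(t)=\lim_{h\downarrow 0}\mathrm{Pr}(N(t+h)=k+1\mid N(t)=k)/h$; similarly $r_k(t)=\lim_{h\downarrow 0}\mathrm{Pr}(N(t+h)=k-1\mid N(t)=k)/h$. *)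

theory Defs
  imports "HOL-Probability.Probability"
begin

record 'v network =
  nodes :: "'v set"
  edges :: "('v \<times> 'v) set"
  act_rate :: "'v \<Rightarrow> 'v \<Rightarrow> real"
  self_rate :: "'v \<Rightarrow> real"
  recov_rate :: "'v \<Rightarrow> real"
  source :: "'v set"

definition propagation_network :: "'v network \<Rightarrow> bool" where
  "propagation_network G \<longleftrightarrow>
     finite (nodes G) \<and> edges G \<subseteq> nodes G \<times> nodes G \<and> source G \<subseteq> nodes G \<and>
     (\<forall>i j. (i, j) \<in> edges G \<longrightarrow> act_rate G i j > 0) \<and>
     (\<forall>i j. (i, j) \<notin> edges G \<longrightarrow> act_rate G i j = 0) \<and>
     (\<forall>i\<in>nodes G. self_rate G i \<ge> 0) \<and> (\<forall>i\<in>nodes G. recov_rate G i \<ge> 0)"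

definition out_nbrs :: "'v network \<Rightarrow> 'v \<Rightarrow> 'v set" where
  "out_nbrs G i = {j. (i, j) \<in> edges G}"

datatype 'v event = Transmit 'v 'v | Self_Activate 'v | Recover 'v

fun event_rate :: "'v network \<Rightarrow> 'v event \<Rightarrow> real" where
  "event_rate G (Transmit i j) = act_rate G i j"
| "event_rate G (Self_Activate i) = self_rate G i"
| "event_rate G (Recover i) = recov_rate G i"

text \<open>Events of rate 0 never happen and carry no clock.\<close>

definition possible_events :: "'v network \<Rightarrow> 'v event set" where
  "possible_events G =
     {e \<in> {Transmit i j |i j. (i, j) \<in> edges G} \<union> Self_Activate ` nodes G \<union> Recover ` nodes G.
        event_rate G e > 0}"

fun enabled :: "'v set \<Rightarrow> 'v event \<Rightarrow> bool" where
  "enabled A (Transmit i j) \<longleftrightarrow> i \<in> A \<and> j \<notin> A"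
| "enabled A (Self_Activate i) \<longleftrightarrow> i \<notin> A"
| "enabled A (Recover i) \<longleftrightarrow> i \<in> A"

fun fire :: "'v event \<Rightarrow> 'v set \<Rightarrow> 'v set" where
  "fire (Transmit i j) A = insert j A"
| "fire (Self_Activate i) A = insert i A"
| "fire (Recover i) A = A - {i}"

definition running :: "'v network \<Rightarrow> 'v set \<Rightarrow> 'v event set" where
  "running G A = {e \<in> possible_events G. enabled A e}"

text \<open>
  The variables \<open>T n e\<close> are the independent exponential times of the process: \<open>T n e\<close> is the
  duration used for the event \<open>e\<close> if its clock is started at the \<open>n\<close>-th change of the active set
  (at time 0 if \<open>n = 0\<close>).
\<close>

definition propagation_clocks ::
  "'w measure \<Rightarrow> 'v network \<Rightarrow> (nat \<Rightarrow> 'v event \<Rightarrow> 'w \<Rightarrow> real) \<Rightarrow> bool" where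
  "propagation_clocks M G T \<longleftrightarrow>
     prob_space M \<and>
     (\<forall>n. \<forall>e\<in>possible_events G.
        distributed M lborel (T n e) (exponential_density (event_rate G e))) \<and>
     prob_space.indep_vars M (\<lambda>_. borel) (\<lambda>(n, e). T n e) (UNIV \<times> possible_events G)"

text \<open>
  A configuration \<open>(A, C)\<close> consists of the active set \<open>A\<close> and, for every running event \<open>e\<close>, the
  absolute time \<open>C e\<close> at which \<open>e\<close> will happen unless it is disabled before. In a step the earliest
  running event happens; a clock that was running keeps its time, and every other clock is restarted
  at the time of the step. Values of \<open>C\<close> at events that are not running are irrelevant: such an
  event gets a new clock whenever it becomes running. Ties have probability 0.
\<close>

type_synonym 'v config = "'v set \<times> ('v event \<Rightarrow> real)"

definition next_time :: "'v network \<Rightarrow> 'v config \<Rightarrow> ereal" where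
  "next_time G = (\<lambda>(A, C). if running G A = {} then \<infinity> else ereal (Min (C ` running G A)))"

definition config_step :: "'v network \<Rightarrow> ('v event \<Rightarrow> real) \<Rightarrow> 'v config \<Rightarrow> 'v config" where
  "config_step G new = (\<lambda>(A, C).
     let s = Min (C ` running G A);
         e = (SOME e. e \<in> running G A \<and> C e = s)
     in (fire e A, \<lambda>e'. if e' \<in> running G A then C e' else s + new e'))"

primrec config ::
  "'v network \<Rightarrow> (nat \<Rightarrow> 'v event \<Rightarrow> 'w \<Rightarrow> real) \<Rightarrow> 'w \<Rightarrow> nat \<Rightarrow> 'v config" where
  "config G T \<omega> 0 = (source G, \<lambda>e. T 0 e \<omega>)"
| "config G T \<omega> (Suc n) = config_step G (\<lambda>e. T (Suc n) e \<omega>) (config G T \<omega> n)"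

text \<open>
  The active set at time \<open>t \<ge> 0\<close> is that of the first configuration whose next step is after \<open>t\<close>.
  A configuration without running events has next step at \<open>\<infinity>\<close>, so it is never left. Infinitely many
  steps in bounded time have probability 0.
\<close>

definition active_set ::
  "'v network \<Rightarrow> (nat \<Rightarrow> 'v event \<Rightarrow> 'w \<Rightarrow> real) \<Rightarrow> real \<Rightarrow> 'w \<Rightarrow> 'v set" where
  "active_set G T t \<omega> =
     fst (config G T \<omega> (LEAST n. ereal t < next_time G (config G T \<omega> n)))"

definition num_active ::
  "'v network \<Rightarrow> (nat \<Rightarrow> 'v event \<Rightarrow> 'w \<Rightarrow> real) \<Rightarrow> real \<Rightarrow> 'w \<Rightarrow> nat" where
  "num_active G T t \<omega> = card (active_set G T t \<omega>)"

definition num_prob ::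
  "'w measure \<Rightarrow> 'v network \<Rightarrow> (nat \<Rightarrow> 'v event \<Rightarrow> 'w \<Rightarrow> real) \<Rightarrow> nat \<Rightarrow> real \<Rightarrow> real" where
  "num_prob M G T k t = \<P>(\<omega> in M. num_active G T t \<omega> = k)"

definition set_prob ::
  "'w measure \<Rightarrow> 'v network \<Rightarrow> (nat \<Rightarrow> 'v event \<Rightarrow> 'w \<Rightarrow> real) \<Rightarrow> real \<Rightarrow> 'v set \<Rightarrow> real" where
  "set_prob M G T t U = \<P>(\<omega> in M. active_set G T t \<omega> = U \<bar> num_active G T t \<omega> = card U)"

text \<open>
  In the downward quotient the condition that the number is \<open>k - 1\<close> is written with \<open>Suc\<close>, so that
  it is impossible for \<open>k = 0\<close>.
\<close>

definition up_quotient ::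
  "'w measure \<Rightarrow> 'v network \<Rightarrow> (nat \<Rightarrow> 'v event \<Rightarrow> 'w \<Rightarrow> real) \<Rightarrow> nat \<Rightarrow> real \<Rightarrow> real \<Rightarrow> real" where
  "up_quotient M G T k t h =
     \<P>(\<omega> in M. num_active G T (t + h) \<omega> = Suc k \<bar> num_active G T t \<omega> = k) / h"

definition down_quotient ::
  "'w measure \<Rightarrow> 'v network \<Rightarrow> (nat \<Rightarrow> 'v event \<Rightarrow> 'w \<Rightarrow> real) \<Rightarrow> nat \<Rightarrow> real \<Rightarrow> real \<Rightarrow> real" where
  "down_quotient M G T k t h =
     \<P>(\<omega> in M. Suc (num_active G T (t + h) \<omega>) = k \<bar> num_active G T t \<omega> = k) / h"

definition up_rate ::
  "'w measure \<Rightarrow> 'v network \<Rightarrow> (nat \<Rightarrow> 'v event \<Rightarrow> 'w \<Rightarrow> real) \<Rightarrow> nat \<Rightarrow> real \<Rightarrow> real" where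
  "up_rate M G T k t = Lim (at_right 0) (up_quotient M G T k t)"

definition down_rate ::
  "'w measure \<Rightarrow> 'v network \<Rightarrow> (nat \<Rightarrow> 'v event \<Rightarrow> 'w \<Rightarrow> real) \<Rightarrow> nat \<Rightarrow> real \<Rightarrow> real" where
  "down_rate M G T k t = Lim (at_right 0) (down_quotient M G T k t)"

definition sets_of_size :: "'v network \<Rightarrow> nat \<Rightarrow> 'v set set" where
  "sets_of_size G k = {U. U \<subseteq> nodes G \<and> card U = k}"

definition total_act :: "'v network \<Rightarrow> 'v set \<Rightarrow> real" where
  "total_act G U = (\<Sum>i\<in>U. \<Sum>j\<in>out_nbrs G i \<inter> (nodes G - U). act_rate G i j)"

definition total_self :: "'v network \<Rightarrow> 'v set \<Rightarrow> real" where
  "total_self G U = (\<Sum>i\<in>U. self_rate G i)"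

definition total_recov :: "'v network \<Rightarrow> 'v set \<Rightarrow> real" where
  "total_recov G U = (\<Sum>i\<in>U. recov_rate G i)"

end

(* Fix the time t and the number n of steps made so far. The course of events up to t uses the clocks
   that are still running only through the fact that they have not rung, so by independence and
   memorylessness each of them rings after t + h with conditional probability exp (- rate * h),
   independently of the others and of the clocks not yet started. If no clock rings in (t, t + h],
   the active set does not change; if only the clock of e rings and all clocks started by this step
   are longer than h, it changes by e. This bounds Pr(X(t) = A, X(t + h) = U) from below by
   Pr(X(t) = A) (delta + h Q(A, U) - C h^2), uniformly in t, where Q is the generator of the chain.
   Summing over U and t in steps of length h shows that no mass escapes to infinitely many steps in
   bounded time. As both sides sum to 1, the lower bounds are also upper bounds up to O(h^2); uniformity
   in t gives the two-sided derivatives of Pr(X(t) = U), and grouping the sets U by size gives the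
   equations for N(t). *)

theory Submission
  imports Defs
begin

subsection \<open>Configurations as functions of the clocks\<close>

text \<open>Each lower bound needs only one explicit scenario on the path; an upper bound would have
  to control several steps within h, ties and infinitely many steps. The bounds hold for every h
  \<ge> 0, being trivial for large h, so no threshold for h is carried along. The obstacle to
  memorylessness is that the step m at which a running clock was started is random, so "the clock of
  e" is not one of the independent variables. Events are therefore split by m; on each piece the
  coordinate (m, e) is integrated with all others fixed, and no conditional distributions appear.
  Positive clocks and increasing step times are almost sure only, so being at step n is described
  without them: the first n steps are not after t, the next one is. All this takes place on the
  product space of the clocks, where a single coordinate can be changed. The given probability space
  enters at the end, through the joint law of its clocks.\<close>

lemma Min_image_cong_above:
  fixes f g :: "'a \<Rightarrow> real"
  assumes "finite R" "x \<in> R" "\<And>y. y \<in> R \<Longrightarrow> y \<noteq> x \<Longrightarrow> g y = f y"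
    and "t < f x" "t < g x" "Min (f ` R) \<le> t"
  shows "Min (g ` R) = Min (f ` R)"
    and "y \<in> R \<Longrightarrow> g y = Min (g ` R) \<longleftrightarrow> f y = Min (f ` R)"
proof -
  have "Min (f ` R) \<in> f ` R"
    using assms(1,2) by (intro Min_in) auto
  then obtain z where z: "z \<in> R" "f z = Min (f ` R)"
    by force
  have "z \<noteq> x"
    using z assms(4,6) by auto
  show eq: "Min (g ` R) = Min (f ` R)"
  proof (rule Min_eqI)
    show "Min (f ` R) \<in> g ` R"
      using z assms(3) \<open>z \<noteq> x\<close> by (metis image_eqI)
    show "Min (f ` R) \<le> w" if w: "w \<in> g ` R" for w
    proof -
      obtain y where y: "y \<in> R" "w = g y"
        using w by blast
      show ?thesis
      proof (cases "y = x")
        case True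
        then show ?thesis using y assms(5,6) by simp
      next
        case False
        then show ?thesis using y assms(1,3) by simp
      qed
    qed
  qed (use assms(1) in simp)
  show "g y = Min (g ` R) \<longleftrightarrow> f y = Min (f ` R)" if "y \<in> R"
    unfolding eq using assms that by (cases "y = x") auto
qed

lemma enabled_fire_neq: "enabled A e \<Longrightarrow> fire e A \<noteq> A"
  by (cases e) auto

lemma not_enabled_fire: "enabled A e \<Longrightarrow> \<not> enabled (fire e A) e"
  by (cases e) auto

lemma fst_config_step:
  "fst (config_step G new c) =
     fire (SOME e. e \<in> running G (fst c) \<and> snd c e = Min (snd c ` running G (fst c))) (fst c)"
  by (simp add: config_step_def Let_def split: prod.splits)

lemma snd_config_step:
  "snd (config_step G new c) e =
     (if e \<in> running G (fst c) then snd c e else Min (snd c ` running G (fst c)) + new e)"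
  by (simp add: config_step_def Let_def split: prod.splits)

lemma next_time_eq:
  "next_time G c =
     (if running G (fst c) = {} then \<infinity> else ereal (Min (snd c ` running G (fst c))))"
  by (simp add: next_time_def split: prod.splits)

text \<open>Both sides evaluate \<open>SOME\<close> on the same predicate, so even at a tie the same
  event is chosen. Due times matter on running events only, since all others are restarted.\<close>

lemma config_step_cong:
  assumes "fst c = fst c'" "\<And>e. e \<in> running G (fst c) \<Longrightarrow> snd c e = snd c' e"
  shows "fst (config_step G new c) = fst (config_step G new' c')"
    and "new e = new' e \<Longrightarrow> snd (config_step G new c) e = snd (config_step G new' c') e"
proof -
  have *: "snd c ` running G (fst c) = snd c' ` running G (fst c)"
    using assms(2) by (intro image_cong) auto
  have eq: "(\<lambda>e. e \<in> running G (fst c) \<and> snd c e = Min (snd c ` running G (fst c))) =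
        (\<lambda>e. e \<in> running G (fst c') \<and> snd c' e = Min (snd c' ` running G (fst c')))"
    using assms * by auto
  show "fst (config_step G new c) = fst (config_step G new' c')"
    unfolding fst_config_step
    by (rule arg_cong2[where f = fire, OF arg_cong[where f = Eps, OF eq] assms(1)])
  show "new e = new' e \<Longrightarrow> snd (config_step G new c) e = snd (config_step G new' c') e"
    unfolding snd_config_step using assms * by auto
qed

text \<open>The first n steps read no later clock, hence \<open>k \<le> n\<close>. The restriction
  to possible events is what later permits a product space with coordinates for these events
  alone.\<close>

lemma config_cong:
  assumes "\<And>k e. k \<le> n \<Longrightarrow> e \<in> possible_events G \<Longrightarrow> T k e \<omega> = T' k e \<omega>'"
  shows "fst (config G T \<omega> n) = fst (config G T' \<omega>' n) \<and>
    (\<forall>e\<in>possible_events G. snd (config G T \<omega> n) e = snd (config G T' \<omega>' n) e)"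
  using assms
proof (induction n)
  case (Suc n)
  then have IH: "fst (config G T \<omega> n) = fst (config G T' \<omega>' n)"
    "\<And>e. e \<in> possible_events G \<Longrightarrow> snd (config G T \<omega> n) e = snd (config G T' \<omega>' n) e"
    by auto
  have *: "snd (config G T \<omega> n) e = snd (config G T' \<omega>' n) e"
    if "e \<in> running G (fst (config G T \<omega> n))" for e
    using that IH(2) by (auto simp: running_def)
  show ?case
    using Suc.prems config_step_cong[OF IH(1) *] by simp
qed auto

lemma next_time_cong:
  assumes "fst c = fst c'" "\<And>e. e \<in> possible_events G \<Longrightarrow> snd c e = snd c' e"
  shows "next_time G c = next_time G c'"
proof -
  have *: "snd c ` running G (fst c) = snd c' ` running G (fst c)"
    using assms(2) by (intro image_cong) (auto simp: running_def)
  show ?thesis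
    using assms(1) * by (simp add: next_time_eq)
qed

lemma active_set_cong:
  assumes "\<And>k e. e \<in> possible_events G \<Longrightarrow> T k e \<omega> = T' k e \<omega>'"
  shows "active_set G T t \<omega> = active_set G T' t \<omega>'"
proof -
  have c: "fst (config G T \<omega> n) = fst (config G T' \<omega>' n)"
    "e \<in> possible_events G \<Longrightarrow> snd (config G T \<omega> n) e = snd (config G T' \<omega>' n) e" for n e
    using config_cong[of n G T \<omega> T' \<omega>'] assms by auto
  have "next_time G (config G T \<omega> n) = next_time G (config G T' \<omega>' n)" for n
    by (rule next_time_cong) (auto simp: c)
  then show ?thesis
    by (simp add: active_set_def c)
qed

section \<open>Paths as functions of a point of the clock space\<close>

type_synonym 'v clocks = "nat \<times> 'v event \<Rightarrow> real"

text \<open>Evaluation takes the place of \<open>T\<close> and the point \<tau> that of \<omega>, so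
  \<open>config\<close> and \<open>active_set\<close> apply verbatim to the canonical space.\<close>

abbreviation (input) coord :: "nat \<Rightarrow> 'v event \<Rightarrow> 'v clocks \<Rightarrow> real" where
  "coord n e \<tau> \<equiv> \<tau> (n, e)"

locale propagation =
  fixes G :: "'v network"
  assumes net: "propagation_network G"
begin

abbreviation "V \<equiv> nodes G"
abbreviation "\<E> \<equiv> possible_events G"
abbreviation "rate \<equiv> event_rate G"

definition act :: "'v clocks \<Rightarrow> nat \<Rightarrow> 'v set" where
  "act \<tau> n = fst (config G coord \<tau> n)"

definition due :: "'v clocks \<Rightarrow> nat \<Rightarrow> 'v event \<Rightarrow> real" where
  "due \<tau> n = snd (config G coord \<tau> n)"

definition next_step :: "'v clocks \<Rightarrow> nat \<Rightarrow> ereal" where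
  "next_step \<tau> n = next_time G (config G coord \<tau> n)"

text \<open>Unlike \<open>active_set G coord t \<tau> = A\<close>, this excludes the case of infinitely many steps
  up to time \<open>t\<close>, in which \<open>active_set\<close> is a junk value.\<close>

definition at_step :: "real \<Rightarrow> nat \<Rightarrow> 'v set \<Rightarrow> 'v clocks \<Rightarrow> bool" where
  "at_step t n A \<tau> \<longleftrightarrow>
     (\<forall>k<n. next_step \<tau> k \<le> ereal t) \<and> ereal t < next_step \<tau> n \<and> act \<tau> n = A"

text \<open>The clock of \<open>e\<close> that is running after \<open>n\<close> steps was started at step \<open>m\<close>, so it rings at
  time \<open>step_time \<tau> m + \<tau> (m, e)\<close>.\<close>

definition held :: "'v clocks \<Rightarrow> 'v event \<Rightarrow> nat \<Rightarrow> nat \<Rightarrow> bool" where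
  "held \<tau> e m n \<longleftrightarrow> m \<le> n \<and> (\<forall>k\<in>{m..n}. e \<in> running G (act \<tau> k)) \<and>
     (m = 0 \<or> e \<notin> running G (act \<tau> (m - 1)))"

definition step_time :: "'v clocks \<Rightarrow> nat \<Rightarrow> real" where
  "step_time \<tau> m = (case m of 0 \<Rightarrow> 0 | Suc k \<Rightarrow> Min (due \<tau> k ` running G (act \<tau> k)))"

lemma finite_nodes [simp, intro]: "finite V"
  using net by (simp add: propagation_network_def)

lemma finite_edges: "finite (edges G)"
  using net finite_subset[of "edges G" "V \<times> V"] by (auto simp: propagation_network_def)

lemma finite_events [simp, intro]: "finite \<E>"
proof (rule finite_subset)
  show "\<E> \<subseteq> (\<lambda>(i, j). Transmit i j) ` edges G \<union> Self_Activate ` V \<union> Recover ` V"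
    by (auto simp: possible_events_def)
  show "finite \<dots>"
    using finite_edges by auto
qed

lemma running_subset: "running G A \<subseteq> \<E>"
  by (auto simp: running_def)

lemma finite_running [simp, intro]: "finite (running G A)"
  using running_subset finite_events by (rule finite_subset)

lemma rate_pos: "e \<in> \<E> \<Longrightarrow> 0 < rate e"
  by (simp add: possible_events_def)

lemma fire_nodes: "e \<in> \<E> \<Longrightarrow> A \<subseteq> V \<Longrightarrow> fire e A \<subseteq> V"
  using net by (auto simp: possible_events_def propagation_network_def)

lemma act_0: "act \<tau> 0 = source G"
  by (simp add: act_def)

lemma due_0: "due \<tau> 0 e = \<tau> (0, e)"
  by (simp add: due_def)

lemma act_Suc:
  "act \<tau> (Suc n) = fire (SOME e. e \<in> running G (act \<tau> n) \<and> due \<tau> n e = step_time \<tau> (Suc n)) (act \<tau> n)"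
  by (simp add: act_def due_def fst_config_step step_time_def)

lemma due_Suc:
  "due \<tau> (Suc n) e =
     (if e \<in> running G (act \<tau> n) then due \<tau> n e else step_time \<tau> (Suc n) + \<tau> (Suc n, e))"
  by (simp add: act_def due_def snd_config_step step_time_def)

lemma next_step_eq:
  "next_step \<tau> n = (if running G (act \<tau> n) = {} then \<infinity> else ereal (step_time \<tau> (Suc n)))"
  by (simp add: next_step_def act_def due_def next_time_eq step_time_def)

lemma step_time_le:
  assumes "e \<in> running G (act \<tau> n)" shows "step_time \<tau> (Suc n) \<le> due \<tau> n e"
  using assms by (simp add: step_time_def)

lemma argmin_event:
  assumes "running G (act \<tau> n) \<noteq> {}"
  obtains e where "e \<in> running G (act \<tau> n)" "due \<tau> n e = step_time \<tau> (Suc n)"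
    "act \<tau> (Suc n) = fire e (act \<tau> n)"
proof -
  have "Min (due \<tau> n ` running G (act \<tau> n)) \<in> due \<tau> n ` running G (act \<tau> n)"
    using assms by (intro Min_in) auto
  then have "\<exists>e. e \<in> running G (act \<tau> n) \<and> due \<tau> n e = step_time \<tau> (Suc n)"
    by (auto simp: step_time_def)
  from someI_ex[OF this] that show ?thesis
    using act_Suc by blast
qed

text \<open>After a step without running events \<open>Min\<close> and \<open>SOME\<close> are
  arbitrary and could lead out of \<open>V\<close>; the hypothesis excludes such steps.\<close>

lemma act_subset:
  assumes "\<And>k. k < n \<Longrightarrow> running G (act \<tau> k) \<noteq> {}"
  shows "act \<tau> n \<subseteq> V"
  using assms
proof (induction n)
  case 0
  then show ?case
    using net by (simp add: act_0 propagation_network_def)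
next
  case (Suc n)
  obtain e where "e \<in> running G (act \<tau> n)" "act \<tau> (Suc n) = fire e (act \<tau> n)"
    using Suc.prems by (meson argmin_event lessI)
  moreover have "act \<tau> n \<subseteq> V"
    using Suc by simp
  ultimately show ?case
    using fire_nodes[of e "act \<tau> n"] running_subset by auto
qed

lemma at_step_less: "at_step t n A \<tau> \<Longrightarrow> k < n \<Longrightarrow> running G (act \<tau> k) \<noteq> {} \<and> step_time \<tau> (Suc k) \<le> t"
  by (force simp: at_step_def next_step_eq split: if_splits)

lemma at_step_act: "at_step t n A \<tau> \<Longrightarrow> act \<tau> n = A"
  by (simp add: at_step_def)

lemma at_step_due: "at_step t n A \<tau> \<Longrightarrow> e \<in> running G A \<Longrightarrow> t < due \<tau> n e"
  using step_time_le[of e \<tau> n] by (auto simp: at_step_def next_step_eq split: if_splits)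

lemma at_stepI:
  assumes "\<And>k. k < n \<Longrightarrow> running G (act \<tau> k) \<noteq> {} \<and> step_time \<tau> (Suc k) \<le> t"
    and "\<And>e. e \<in> running G A \<Longrightarrow> t < due \<tau> n e" and "act \<tau> n = A"
  shows "at_step t n A \<tau>"
proof -
  have "ereal t < next_step \<tau> n"
  proof (cases "running G A = {}")
    case False
    obtain e where "e \<in> running G (act \<tau> n)" "due \<tau> n e = step_time \<tau> (Suc n)"
      by (rule argmin_event[of \<tau> n]) (use False assms(3) in auto)
    then show ?thesis
      using assms(2)[of e] assms(3) by (auto simp: next_step_eq)
  qed (use assms(3) in \<open>simp add: next_step_eq\<close>)
  then show ?thesis
    using assms(1,3) unfolding at_step_def by (simp add: next_step_eq)
qed

lemma at_step_unique:
  assumes "at_step t n A \<tau>" "at_step t m B \<tau>"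
  shows "n = m" "A = B"
proof -
  show "n = m"
    using assms unfolding at_step_def by (metis linorder_neqE_nat not_less)
  then show "A = B"
    using assms by (simp add: at_step_def)
qed

lemma at_step_active_set:
  assumes "at_step t n A \<tau>"
  shows "active_set G coord t \<tau> = A"
proof -
  have "(LEAST n. ereal t < next_step \<tau> n) = n"
    using assms unfolding at_step_def by (intro Least_equality) (auto simp: not_less[symmetric])
  then show ?thesis
    using assms by (simp add: active_set_def at_step_def act_def next_step_def)
qed

text \<open>The start m is the least beginning of an uninterrupted stretch of running that reaches
  step n; if e were running just before it, the stretch could be extended.\<close>

lemma at_step_held:
  assumes "at_step t n A \<tau>" "e \<in> running G A"
  shows "\<exists>m\<le>n. held \<tau> e m n"
proof -
  define P where "P m \<longleftrightarrow> m \<le> n \<and> (\<forall>k\<in>{m..n}. e \<in> running G (act \<tau> k))" for m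
  have "P n"
    using assms at_step_act by (auto simp: P_def)
  define m where "m = (LEAST m. P m)"
  have m: "P m"
    unfolding m_def by (rule LeastI) fact
  have "\<not> P (m - 1)" if "m \<noteq> 0"
    using that not_less_Least[of "m - 1" P] by (simp add: m_def)
  moreover have "P (m - 1)" if "m \<noteq> 0" "e \<in> running G (act \<tau> (m - 1))"
  proof -
    have "{m - 1..n} = insert (m - 1) {m..n}"
      using that(1) m by (auto simp: P_def)
    then show ?thesis
      using that m by (auto simp: P_def)
  qed
  ultimately have "m = 0 \<or> e \<notin> running G (act \<tau> (m - 1))"
    by blast
  then have "held \<tau> e m n"
    using m by (simp add: held_def P_def)
  then show ?thesis
    using m P_def by blast
qed

text \<open>A later start b requires that e does not run at step b - 1, which lies in the stretch of
  the earlier start. This makes the pieces in \<open>prob_hold_insert\<close> disjoint.\<close>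

lemma held_unique:
  assumes "held \<tau> e m n" "held \<tau> e m' n" shows "m = m'"
proof -
  have *: "\<not> a < b" if "held \<tau> e a n" "held \<tau> e b n" for a b
  proof
    assume "a < b"
    moreover have "b \<le> n" using that by (simp add: held_def)
    ultimately have "b - 1 \<in> {a..n}" "b \<noteq> 0" by auto
    then show False using that unfolding held_def by metis
  qed
  show ?thesis
    using *[OF assms] *[OF assms(2,1)] by simp
qed

lemma due_held:
  assumes "\<forall>k\<in>{m..n}. e \<in> running G (act \<tau> k)" "m = 0 \<or> e \<notin> running G (act \<tau> (m - 1))"
    and "m \<le> k" "k \<le> n"
  shows "due \<tau> k e = step_time \<tau> m + \<tau> (m, e)"
  using assms(3,4)
proof (induction k rule: dec_induct)
  case base
  then show ?case
    using assms(2) by (cases m) (auto simp: due_0 due_Suc step_time_def)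
next
  case (step k)
  then show ?case
    using assms(1) by (auto simp: due_Suc)
qed

text \<open>A running clock that has not rung up to time \<open>t\<close> influences the course of events up to time
  \<open>t\<close> only through this fact, not through its value.\<close>

lemma replace_clock:
  assumes at: "at_step t n A \<tau>" and held: "held \<tau> e m n"
    and y: "t < step_time \<tau> m + y"
  defines "\<tau>' \<equiv> \<tau>((m, e) := y)"
  shows "at_step t n A \<tau>'" "held \<tau>' e m n" "step_time \<tau>' m = step_time \<tau> m"
    and "\<And>e'. e' \<noteq> e \<Longrightarrow> due \<tau>' n e' = due \<tau> n e'"
proof -
  have m: "m \<le> n" and run: "\<And>k. k \<in> {m..n} \<Longrightarrow> e \<in> running G (act \<tau> k)"
    and start: "m = 0 \<or> e \<notin> running G (act \<tau> (m - 1))"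
    using held by (auto simp: held_def)
  have e: "e \<in> running G A"
    using run[of n] m at_step_act[OF at] by simp
  have due_e: "due \<tau> k e = step_time \<tau> m + \<tau> (m, e)" if "m \<le> k" "k \<le> n" for k
    using due_held[of m n e \<tau> k] run start that by simp
  have old: "t < step_time \<tau> m + \<tau> (m, e)"
    using at_step_due[OF at e] due_e[of n] m by simp
  \<comment> \<open>Invariant: the two runs differ only in the due time of e, and only from step m
    on; before that, the changed coordinate has not been read.\<close>
  have "act \<tau>' k = act \<tau> k \<and> step_time \<tau>' k = step_time \<tau> k \<and>
    (\<forall>e'. due \<tau>' k e' = (if e' = e \<and> m \<le> k then step_time \<tau> m + y else due \<tau> k e'))"
    if "k \<le> n" for k
    using that
  proof (induction k)
    case 0
    then show ?case
      by (auto simp: act_0 due_0 step_time_def \<tau>'_def)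
  next
    case (Suc k)
    let ?R = "running G (act \<tau> k)"
    have IH: "act \<tau>' k = act \<tau> k"
      "\<And>e'. due \<tau>' k e' = (if e' = e \<and> m \<le> k then step_time \<tau> m + y else due \<tau> k e')"
      using Suc by auto
    have R: "step_time \<tau> (Suc k) \<le> t"
      using at_step_less[OF at, of k] Suc.prems by auto
    have st: "step_time \<tau>' (Suc k) = step_time \<tau> (Suc k)"
      and eq: "\<And>e'. e' \<in> ?R \<Longrightarrow> due \<tau>' k e' = step_time \<tau>' (Suc k) \<longleftrightarrow> due \<tau> k e' = step_time \<tau> (Suc k)"
    proof -
      have "step_time \<tau>' (Suc k) = step_time \<tau> (Suc k) \<and>
        (\<forall>e'\<in>?R. due \<tau>' k e' = step_time \<tau>' (Suc k) \<longleftrightarrow> due \<tau> k e' = step_time \<tau> (Suc k))"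
      proof (cases "m \<le> k")
        case True
        \<comment> \<open>Step k + 1 is not after t, while e is due after t in both runs. So the
          minimum and all ties for it are attained away from e, and the same events compete to
          fire.\<close>
        have "Min (due \<tau>' k ` ?R) = Min (due \<tau> k ` ?R)"
          "\<And>e'. e' \<in> ?R \<Longrightarrow> due \<tau>' k e' = Min (due \<tau>' k ` ?R) \<longleftrightarrow> due \<tau> k e' = Min (due \<tau> k ` ?R)"
          using Min_image_cong_above[of ?R e "due \<tau>' k" "due \<tau> k" t] run[of k] True IH R y old
            due_e[of k] Suc.prems
          by (auto simp: step_time_def)
        then show ?thesis
          by (simp add: step_time_def IH(1))
      next
        case False
        then have "due \<tau>' k = due \<tau> k"
          using IH(2) by auto
        then show ?thesis
          by (simp add: step_time_def IH(1))
      qed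
      then show "step_time \<tau>' (Suc k) = step_time \<tau> (Suc k)"
        "\<And>e'. e' \<in> ?R \<Longrightarrow> due \<tau>' k e' = step_time \<tau>' (Suc k) \<longleftrightarrow> due \<tau> k e' = step_time \<tau> (Suc k)"
        by blast+
    qed
    have arg: "(\<lambda>e'. e' \<in> running G (act \<tau>' k) \<and> due \<tau>' k e' = step_time \<tau>' (Suc k)) =
      (\<lambda>e'. e' \<in> running G (act \<tau> k) \<and> due \<tau> k e' = step_time \<tau> (Suc k))"
    proof
      fix e'
      show "(e' \<in> running G (act \<tau>' k) \<and> due \<tau>' k e' = step_time \<tau>' (Suc k)) =
        (e' \<in> running G (act \<tau> k) \<and> due \<tau> k e' = step_time \<tau> (Suc k))"
        unfolding IH(1) using eq[of e'] by blast
    qed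
    have "act \<tau>' (Suc k) = act \<tau> (Suc k)"
      unfolding act_Suc
      by (rule arg_cong2[where f = fire, OF arg_cong[where f = Eps, OF arg] IH(1)])
    moreover have "due \<tau>' (Suc k) e' =
      (if e' = e \<and> m \<le> Suc k then step_time \<tau> m + y else due \<tau> (Suc k) e')" for e'
    proof (cases "e' = e")
      case True
      \<comment> \<open>The clock of e is carried along, set at this step, or not yet set. The
        coordinate (m, e) is read in the second case, where \<open>start\<close> says that e was not
        running before.\<close>
      consider "m \<le> k" | "m = Suc k" | "Suc k < m"
        by linarith
      then show ?thesis
      proof cases
        case 1
        then show ?thesis
          using True run[of k] Suc.prems IH by (simp add: due_Suc)
      next
        case 2
        then show ?thesis
          using True start IH st by (simp add: due_Suc \<tau>'_def)
      next
        case 3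
        then show ?thesis
          using True IH st by (simp add: due_Suc \<tau>'_def)
      qed
    next
      case False
      then show ?thesis
        using IH st by (simp add: due_Suc \<tau>'_def)
    qed
    ultimately show ?case
      using st by simp
  qed
  note * = this
  have act: "act \<tau>' k = act \<tau> k" "step_time \<tau>' k = step_time \<tau> k" if "k \<le> n" for k
    using *[OF that] by auto
  show "step_time \<tau>' m = step_time \<tau> m"
    using act m by simp
  show due': "due \<tau>' n e' = due \<tau> n e'" if "e' \<noteq> e" for e'
    using *[of n] that by auto
  show "held \<tau>' e m n"
    using held act by (auto simp: held_def)
  show "at_step t n A \<tau>'"
  proof (rule at_stepI)
    show "running G (act \<tau>' k) \<noteq> {} \<and> step_time \<tau>' (Suc k) \<le> t" if "k < n" for k
      using at_step_less[OF at that] act[of k] act[of "Suc k"] that by simp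
    show "t < due \<tau>' n e'" if "e' \<in> running G A" for e'
      using at_step_due[OF at that] *[of n] y m by auto
    show "act \<tau>' n = A"
      using act[of n] at_step_act[OF at] by simp
  qed
qed

section \<open>Staying or jumping once between t and t + h\<close>

lemma at_step_stay:
  assumes at: "at_step t n A \<tau>" and "0 \<le> h" and "\<And>e. e \<in> running G A \<Longrightarrow> t + h < due \<tau> n e"
  shows "at_step (t + h) n A \<tau>"
proof (rule at_stepI)
  show "running G (act \<tau> k) \<noteq> {} \<and> step_time \<tau> (Suc k) \<le> t + h" if "k < n" for k
    using at_step_less[OF at that] assms(2) by auto
qed (use assms at_step_act in auto)

text \<open>Only e is due by t + h, so it is the unique minimiser and \<open>SOME\<close> must
  choose it. Firing disables e, so every clock running afterwards is either an old one due after t +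
  h or a new one that starts after t and lasts longer than h.\<close>

lemma at_step_jump:
  assumes at: "at_step t n A \<tau>" and "0 \<le> h" and e: "e \<in> running G A" "due \<tau> n e \<le> t + h"
    and others: "\<And>e'. e' \<in> running G A \<Longrightarrow> e' \<noteq> e \<Longrightarrow> t + h < due \<tau> n e'"
    and fresh: "\<And>e'. e' \<in> \<E> \<Longrightarrow> h < \<tau> (Suc n, e')"
  shows "at_step (t + h) (Suc n) (fire e A) \<tau>"
proof -
  note A = at_step_act[OF at]
  have R: "running G (act \<tau> n) \<noteq> {}"
    using e A by auto
  obtain e0 where e0: "e0 \<in> running G (act \<tau> n)" "due \<tau> n e0 = step_time \<tau> (Suc n)"
    "act \<tau> (Suc n) = fire e0 (act \<tau> n)"
    using argmin_event[OF R] by blast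
  have st: "step_time \<tau> (Suc n) \<le> due \<tau> n e" "t < step_time \<tau> (Suc n)"
    using step_time_le[of e \<tau> n] e A at_step_due[OF at, of e0] e0 by auto
  then have "e0 = e"
    using others[of e0] e0 A e(2) by force
  show ?thesis
  proof (rule at_stepI)
    show "running G (act \<tau> k) \<noteq> {} \<and> step_time \<tau> (Suc k) \<le> t + h" if "k < Suc n" for k
    proof (cases "k = n")
      case True
      then show ?thesis
        using R st e by simp
    next
      case False
      then show ?thesis
        using at_step_less[OF at, of k] that assms(2) by force
    qed
    show "act \<tau> (Suc n) = fire e A"
      using e0 \<open>e0 = e\<close> A by simp
    show "t + h < due \<tau> (Suc n) e'" if e': "e' \<in> running G (fire e A)" for e'
    proof (cases "e' \<in> running G A")
      case True
      have "enabled A e" "enabled (fire e A) e'"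
        using e e' by (auto simp: running_def)
      then have "e' \<noteq> e"
        using not_enabled_fire by blast
      then show ?thesis
        using True others A by (simp add: due_Suc)
    next
      case False
      then show ?thesis
        using fresh[of e'] e' running_subset st A by (auto simp: due_Suc intro: add_strict_mono)
    qed
  qed
qed

text \<open>Clocks of later steps have not been read by step n; this is the source of the
  independence of fresh clocks in \<open>prob_jump_ge\<close>.\<close>

lemma at_step_fresh:
  assumes "\<And>k e. k \<le> n \<Longrightarrow> \<tau>' (k, e) = \<tau> (k, e)"
  shows "at_step t n A \<tau>' \<longleftrightarrow> at_step t n A \<tau>"
    and "e \<in> \<E> \<Longrightarrow> due \<tau>' n e = due \<tau> n e" and "act \<tau>' n = act \<tau> n"
proof -
  have c: "fst (config G coord \<tau>' k) = fst (config G coord \<tau> k)"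
    "e \<in> \<E> \<Longrightarrow> snd (config G coord \<tau>' k) e = snd (config G coord \<tau> k) e" if "k \<le> n" for k e
    using config_cong[of k G coord \<tau>' coord \<tau>] assms that by auto
  have "next_step \<tau>' k = next_step \<tau> k" if "k \<le> n" for k
    unfolding next_step_def by (rule next_time_cong) (use c that in auto)
  then show "at_step t n A \<tau>' \<longleftrightarrow> at_step t n A \<tau>"
    using c by (auto simp: at_step_def act_def)
  show "e \<in> \<E> \<Longrightarrow> due \<tau>' n e = due \<tau> n e" "act \<tau>' n = act \<tau> n"
    using c by (auto simp: due_def act_def)
qed

end

subsection \<open>The product space of the clocks\<close>

text \<open>A choice by \<open>SOME\<close> depends on the clocks only through the set of
  minimisers. This set has finitely many values, each taken on a measurable event, so f may be
  arbitrary.\<close>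

lemma measurable_choice_min:
  fixes C :: "'a \<Rightarrow> 'b \<Rightarrow> real" and f :: "'a set \<Rightarrow> 'c"
  assumes "finite R" and [measurable]: "\<And>e. e \<in> R \<Longrightarrow> C e \<in> borel_measurable M"
    and "\<And>Q. Q \<subseteq> R \<Longrightarrow> f Q \<in> B"
  shows "(\<lambda>x. f {e \<in> R. C e x = Min ((\<lambda>e. C e x) ` R)}) \<in> measurable M (count_space B)"
proof (rule measurable_compose[where N = "count_space (Pow R)" and g = f
      and f = "\<lambda>x. {e \<in> R. C e x = Min ((\<lambda>e. C e x) ` R)}"])
  have [measurable]: "(\<lambda>x. Min ((\<lambda>e. C e x) ` R)) \<in> borel_measurable M"
    using assms by (intro borel_measurable_Min) auto
  show "(\<lambda>x. {e \<in> R. C e x = Min ((\<lambda>e. C e x) ` R)}) \<in> measurable M (count_space (Pow R))"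
    unfolding measurable_count_space_eq2[OF finite_Pow_iff[THEN iffD2, OF assms(1)]]
  proof (intro conjI ballI)
    fix Q assume "Q \<in> Pow R"
    then have "Q \<subseteq> R" by simp
    have "(\<lambda>x. {e \<in> R. C e x = Min ((\<lambda>e. C e x) ` R)}) -` {Q} \<inter> space M =
      {x \<in> space M. \<forall>e\<in>R. (C e x = Min ((\<lambda>e. C e x) ` R)) = (e \<in> Q)}"
      using \<open>Q \<subseteq> R\<close> by auto
    also have "\<dots> \<in> sets M"
      using assms(1) by measurable
    finally show "(\<lambda>x. {e \<in> R. C e x = Min ((\<lambda>e. C e x) ` R)}) -` {Q} \<inter> space M \<in> sets M" .
  qed auto
  show "f \<in> measurable (count_space (Pow R)) (count_space B)"
    using assms(3) by auto
qed

lemma measure_exponential_greaterThan: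
  assumes "0 < l" "0 \<le> a"
  shows "measure (density lborel (exponential_density l)) {a<..} = exp (- a * l)"
proof -
  interpret E: prob_space "density lborel (exponential_density l)"
    using assms by (intro prob_space_exponential_density)
  have "distributed (density lborel (exponential_density l)) lborel (\<lambda>x. x) (exponential_density l)"
    by (auto simp: distributed_def distr_id2)
  from E.exponential_distributedD_gt[OF this assms(2,1)] show ?thesis
    by (simp add: greaterThan_def)
qed

context propagation
begin

definition clock_law :: "nat \<times> 'v event \<Rightarrow> real measure" where
  "clock_law i = density lborel (exponential_density (rate (snd i)))"

abbreviation clock_index :: "(nat \<times> 'v event) set" where
  "clock_index \<equiv> UNIV \<times> \<E>"

definition clock_space :: "'v clocks measure" where
  "clock_space = PiM clock_index clock_law"

lemma prob_space_clock_law: "i \<in> clock_index \<Longrightarrow> prob_space (clock_law i)"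
  unfolding clock_law_def using rate_pos by (intro prob_space_exponential_density) auto

lemma prob_space_clock_space: "prob_space clock_space"
  unfolding clock_space_def by (intro prob_space_PiM prob_space_clock_law)

lemma sets_clock_law [measurable_cong, simp]: "sets (clock_law i) = sets borel"
  by (simp add: clock_law_def)

lemma space_clock_law [simp]: "space (clock_law i) = UNIV"
  by (simp add: clock_law_def)

lemma measurable_clock [measurable]: "i \<in> clock_index \<Longrightarrow> (\<lambda>\<tau>. \<tau> i) \<in> borel_measurable clock_space"
  unfolding clock_space_def using measurable_component_singleton[of i clock_index clock_law]
  by (simp cong: measurable_cong_sets)

lemma space_clock_space: "space clock_space = (\<Pi>\<^sub>E i\<in>clock_index. UNIV)"
  by (simp add: clock_space_def space_PiM)

lemma fun_upd_space_clock_space: "\<tau> \<in> space clock_space \<Longrightarrow> i \<in> clock_index \<Longrightarrow> \<tau>(i := y) \<in> space clock_space"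
  by (auto simp: space_clock_space PiE_def extensional_def)

text \<open>The running events depend on the random active set, so measurability is shown with this
  set frozen at each of its values and then glued. The finite range has to be part of the induction
  for that.\<close>

lemma measurable_act_due:
  "(\<exists>\<A>. finite \<A> \<and> (\<lambda>\<tau>. act \<tau> n) \<in> measurable clock_space (count_space \<A>)) \<and>
   (\<forall>e\<in>\<E>. (\<lambda>\<tau>. due \<tau> n e) \<in> borel_measurable clock_space)"
proof (induction n)
  case 0
  have "(\<lambda>\<tau>. act \<tau> 0) \<in> measurable clock_space (count_space {source G})"
    by (simp add: act_0)
  moreover have "(\<lambda>\<tau>. due \<tau> 0 e) \<in> borel_measurable clock_space" if "e \<in> \<E>" for e
    using that by (simp add: due_0)
  ultimately show ?case
    by blast
next
  case (Suc n)
  then obtain \<A> where \<A>: "finite \<A>" "(\<lambda>\<tau>. act \<tau> n) \<in> measurable clock_space (count_space \<A>)"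
    by blast
  have due: "(\<lambda>\<tau>. due \<tau> n e) \<in> borel_measurable clock_space" if "e \<in> running G A" for e A
    using that Suc running_subset by blast
  define sel :: "'v event set \<Rightarrow> 'v event" where "sel Q = (SOME e. e \<in> Q)" for Q
  \<comment> \<open>The value \<open>sel {}\<close> covers sets without running events, where the
    selected event is arbitrary.\<close>
  define \<B> where "\<B> = (\<lambda>(e, A). fire e A) ` (insert (sel {}) \<E> \<times> \<A>)"
  have sel: "sel Q \<in> insert (sel {}) \<E>" if "Q \<subseteq> running G A" for Q A
    using that running_subset[of A] someI_ex[of "\<lambda>e. e \<in> Q"] by (cases "Q = {}") (auto simp: sel_def)
  let ?m = "\<lambda>A \<tau>. Min (due \<tau> n ` running G A)"
  have min: "?m A \<in> borel_measurable clock_space" for A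
    using due by (intro borel_measurable_Min) auto
  have "(\<lambda>\<tau>. fire (sel {e \<in> running G (act \<tau> n). due \<tau> n e = ?m (act \<tau> n) \<tau>}) (act \<tau> n))
      \<in> measurable clock_space (count_space \<B>)"
  proof (rule measurable_compose_countable'[OF _ \<A>(2)])
    fix A assume "A \<in> \<A>"
    then show "(\<lambda>\<tau>. fire (sel {e \<in> running G A. due \<tau> n e = ?m A \<tau>}) A) \<in> measurable clock_space (count_space \<B>)"
      using sel due
      by (intro measurable_choice_min[where C = "\<lambda>e \<tau>. due \<tau> n e" and f = "\<lambda>Q. fire (sel Q) A"])
         (auto simp: \<B>_def)
  qed (use \<A> in \<open>auto intro: countable_finite\<close>)
  then have "(\<lambda>\<tau>. act \<tau> (Suc n)) \<in> measurable clock_space (count_space \<B>)"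
    by (simp add: act_Suc step_time_def sel_def)
  moreover have "finite \<B>"
    using \<A> by (simp add: \<B>_def)
  moreover have "(\<lambda>\<tau>. due \<tau> (Suc n) e) \<in> borel_measurable clock_space" if e: "e \<in> \<E>" for e
  proof -
    have "(\<lambda>\<tau>. if e \<in> running G (act \<tau> n) then due \<tau> n e else ?m (act \<tau> n) \<tau> + \<tau> (Suc n, e))
        \<in> borel_measurable clock_space"
    proof (rule measurable_compose_countable'[OF _ \<A>(2)])
      fix A
      show "(\<lambda>\<tau>. if e \<in> running G A then due \<tau> n e else ?m A \<tau> + \<tau> (Suc n, e)) \<in> borel_measurable clock_space"
        using due min e by (cases "e \<in> running G A") auto
    qed (use \<A> in \<open>auto intro: countable_finite\<close>)
    then show ?thesis
      unfolding due_Suc step_time_def nat.case .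
  qed
  ultimately show ?case
    by blast
qed

lemma measurable_act [measurable]: "(\<lambda>\<tau>. act \<tau> n) \<in> measurable clock_space (count_space UNIV)"
proof -
  obtain \<A> where "(\<lambda>\<tau>. act \<tau> n) \<in> measurable clock_space (count_space \<A>)"
    using measurable_act_due by blast
  then show ?thesis
    using measurable_compose[of _ clock_space "count_space \<A>" "\<lambda>A. A" "count_space UNIV"] by simp
qed

lemma measurable_due [measurable]: "e \<in> \<E> \<Longrightarrow> (\<lambda>\<tau>. due \<tau> n e) \<in> borel_measurable clock_space"
  using measurable_act_due[of n] by blast

lemma measurable_next_step [measurable]: "(\<lambda>\<tau>. next_step \<tau> n) \<in> borel_measurable clock_space"
proof -
  obtain \<A> where \<A>: "finite \<A>" "(\<lambda>\<tau>. act \<tau> n) \<in> measurable clock_space (count_space \<A>)"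
    using measurable_act_due by blast
  have "(\<lambda>\<tau>. if running G (act \<tau> n) = {} then \<infinity> else ereal (Min (due \<tau> n ` running G (act \<tau> n))))
    \<in> borel_measurable clock_space"
  proof (rule measurable_compose_countable'[OF _ \<A>(2)])
    fix A
    have "(\<lambda>\<tau>. Min (due \<tau> n ` running G A)) \<in> borel_measurable clock_space"
      by (intro borel_measurable_Min measurable_due[OF subsetD[OF running_subset]]) auto
    then show "(\<lambda>\<tau>. if running G A = {} then \<infinity> else ereal (Min (due \<tau> n ` running G A)))
      \<in> borel_measurable clock_space"
      by simp
  qed (use \<A> in \<open>auto intro: countable_finite\<close>)
  then show ?thesis
    unfolding next_step_eq step_time_def nat.case .
qed

lemma pred_act: "Measurable.pred clock_space (\<lambda>\<tau>. Q (act \<tau> n))"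
  using measurable_compose[OF measurable_act[of n], of Q "count_space UNIV"] by simp

lemma pred_at_step [measurable]: "Measurable.pred clock_space (at_step t n A)"
  unfolding at_step_def by (intro pred_intros_logic pred_intros_countable pred_act) measurable

lemma pred_held [measurable]: "Measurable.pred clock_space (\<lambda>\<tau>. held \<tau> e m n)"
  unfolding held_def
  by (intro pred_intros_logic pred_intros_finite pred_act) auto

lemma measurable_active_set [measurable]:
  "active_set G coord t \<in> measurable clock_space (count_space UNIV)"
proof -
  have [measurable]: "(\<lambda>\<tau>. LEAST n. ereal t < next_step \<tau> n) \<in> measurable clock_space (count_space UNIV)"
    by measurable
  have "(\<lambda>\<tau>. act \<tau> (LEAST n. ereal t < next_step \<tau> n)) \<in> measurable clock_space (count_space UNIV)"
    by (rule measurable_compose_countable[where f = "\<lambda>n \<tau>. act \<tau> n"]) measurable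
  then show ?thesis
    unfolding active_set_def act_def next_step_def by simp
qed

section \<open>Integration over one coordinate, fresh clocks and memorylessness\<close>

sublocale prob_space clock_space
  by (rule prob_space_clock_space)

text \<open>Fubini: the product measure is the image of \<open>clock_law i\<close> times the law of
  the other coordinates, so a factor c between all slices along i passes to the
  probabilities.\<close>

lemma prob_coordinate_scale:
  assumes i: "i \<in> clock_index" and D: "D \<in> sets clock_space" "D' \<in> sets clock_space" and "0 \<le> c"
    and slice: "\<And>\<tau>. \<tau> \<in> space clock_space \<Longrightarrow>
      measure (clock_law i) {y. \<tau>(i := y) \<in> D'} = c * measure (clock_law i) {y. \<tau>(i := y) \<in> D}"
  shows "prob D' = c * prob D"
proof -
  define Z where "Z = PiM (clock_index - {i}) clock_law"
  interpret L: prob_space "clock_law i"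
    using prob_space_clock_law[OF i] .
  interpret Z: prob_space Z
    unfolding Z_def by (intro prob_space_PiM prob_space_clock_law) auto
  interpret LZ: pair_prob_space "clock_law i" Z ..
  have ins: "insert i (clock_index - {i}) = clock_index"
    using i by blast
  have distr: "distr (clock_law i \<Otimes>\<^sub>M Z) clock_space (\<lambda>(x, X). X(i := x)) = clock_space"
    using distr_pair_PiM_eq_PiM[of "clock_index - {i}" clock_law i] prob_space_clock_law i
    unfolding ins clock_space_def Z_def by auto
  have meas: "(\<lambda>(x, X). X(i := x)) \<in> measurable (clock_law i \<Otimes>\<^sub>M Z) clock_space"
  proof -
    have "(\<lambda>(x, X). X(i := x)) \<in> measurable (clock_law i \<Otimes>\<^sub>M Z) (PiM (insert i (clock_index - {i})) clock_law)"
      unfolding Z_def split_beta by (rule measurable_fun_upd[where J = "clock_index - {i}"]) measurable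
    then show ?thesis
      unfolding ins clock_space_def .
  qed
  \<comment> \<open>The value 0 is overwritten in every slice; it only turns z into a point of the
    clock space, where \<open>slice\<close> applies.\<close>
  have upd: "z(i := 0) \<in> space clock_space" if "z \<in> space Z" for z
    using that i by (auto simp: Z_def space_clock_space space_PiM PiE_def extensional_def)
  have em: "emeasure clock_space X = (\<integral>\<^sup>+ z. emeasure (clock_law i) {y. z(i := y) \<in> X} \<partial>Z)"
    if X: "X \<in> sets clock_space" for X
  proof -
    have "emeasure clock_space X = emeasure (distr (clock_law i \<Otimes>\<^sub>M Z) clock_space (\<lambda>(x, X). X(i := x))) X"
      by (simp add: distr)
    also have "\<dots> = emeasure (clock_law i \<Otimes>\<^sub>M Z) ((\<lambda>(x, X). X(i := x)) -` X \<inter> space (clock_law i \<Otimes>\<^sub>M Z))"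
      by (rule emeasure_distr[OF meas X])
    also have "\<dots> = (\<integral>\<^sup>+ z. emeasure (clock_law i)
        ((\<lambda>y. (y, z)) -` ((\<lambda>(x, X). X(i := x)) -` X \<inter> space (clock_law i \<Otimes>\<^sub>M Z))) \<partial>Z)"
      by (rule LZ.emeasure_pair_measure_alt2) (rule measurable_sets[OF meas X])
    also have "\<dots> = (\<integral>\<^sup>+ z. emeasure (clock_law i) {y. z(i := y) \<in> X} \<partial>Z)"
      by (rule nn_integral_cong) (auto intro!: arg_cong2[where f = emeasure] simp: space_pair_measure)
    finally show ?thesis .
  qed
  have em_meas: "(\<lambda>z. emeasure (clock_law i) {y. z(i := y) \<in> D}) \<in> borel_measurable Z"
  proof -
    have "(\<lambda>z. emeasure (clock_law i)
        ((\<lambda>y. (y, z)) -` ((\<lambda>(x, X). X(i := x)) -` D \<inter> space (clock_law i \<Otimes>\<^sub>M Z)))) \<in> borel_measurable Z"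
      by (rule LZ.measurable_emeasure_Pair2) (rule measurable_sets[OF meas D(1)])
    also have "?this \<longleftrightarrow> ?thesis"
      by (rule measurable_cong) (auto intro!: arg_cong2[where f = emeasure] simp: space_pair_measure)
    finally show ?thesis .
  qed
  have "emeasure (clock_law i) {y. z(i := y) \<in> D'} = ennreal c * emeasure (clock_law i) {y. z(i := y) \<in> D}"
    if "z \<in> space Z" for z
    using slice[OF upd[OF that]] \<open>0 \<le> c\<close> by (simp add: L.emeasure_eq_measure ennreal_mult)
  then have "emeasure clock_space D' = (\<integral>\<^sup>+ z. ennreal c * emeasure (clock_law i) {y. z(i := y) \<in> D} \<partial>Z)"
    unfolding em[OF D(2)] by (rule nn_integral_cong)
  also have "\<dots> = ennreal c * emeasure clock_space D"
    unfolding em[OF D(1)] by (rule nn_integral_cmult) (rule em_meas)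
  finally show ?thesis
    using \<open>0 \<le> c\<close> by (simp add: emeasure_eq_measure ennreal_mult[symmetric])
qed

lemma measure_clock_greaterThan:
  assumes "e \<in> \<E>" "0 \<le> a"
  shows "measure (clock_law (n, e)) {a<..} = exp (- a * rate e)"
  unfolding clock_law_def using measure_exponential_greaterThan rate_pos assms by simp

text \<open>As W ignores the coordinate (n, e), each slice of W is everything or empty, and the
  additional condition multiplies its measure by the exponential tail.\<close>

lemma prob_fresh:
  assumes e: "e \<in> \<E>" and W: "W \<in> sets clock_space" and "0 \<le> h"
    and inv: "\<And>\<tau> y. \<tau> \<in> space clock_space \<Longrightarrow> \<tau>((n, e) := y) \<in> W \<longleftrightarrow> \<tau> \<in> W"
  shows "prob {\<tau> \<in> W. h < \<tau> (n, e)} = exp (- h * rate e) * prob W"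
proof (rule prob_coordinate_scale)
  show i: "(n, e) \<in> clock_index" using e by simp
  have "{\<tau> \<in> W. h < \<tau> (n, e)} = W \<inter> {\<tau> \<in> space clock_space. h < \<tau> (n, e)}"
    using sets.sets_into_space[OF W] by auto
  also have "\<dots> \<in> sets clock_space"
  proof -
    have "(\<lambda>\<tau>. \<tau> (n, e)) \<in> borel_measurable clock_space"
      using e by simp
    then have "{\<tau> \<in> space clock_space. h < \<tau> (n, e)} \<in> sets clock_space"
      by (simp add: borel_measurable_iff_greater)
    then show ?thesis
      using W by (intro sets.Int)
  qed
  finally show "{\<tau> \<in> W. h < \<tau> (n, e)} \<in> sets clock_space" .
  fix \<tau> assume \<tau>: "\<tau> \<in> space clock_space"
  interpret L: prob_space "clock_law (n, e)"
    using prob_space_clock_law[OF i] .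
  show "measure (clock_law (n, e)) {y. \<tau>((n, e) := y) \<in> {\<tau> \<in> W. h < \<tau> (n, e)}} =
    exp (- h * rate e) * measure (clock_law (n, e)) {y. \<tau>((n, e) := y) \<in> W}"
  proof (cases "\<tau> \<in> W")
    case True
    then have "{y. \<tau>((n, e) := y) \<in> {\<tau> \<in> W. h < \<tau> (n, e)}} = {h<..}"
      "{y. \<tau>((n, e) := y) \<in> W} = space (clock_law (n, e))"
      using inv[OF \<tau>] by auto
    then show ?thesis
      using measure_clock_greaterThan[OF e \<open>0 \<le> h\<close>] L.prob_space by simp
  qed (simp add: inv[OF \<tau>])
qed (use W in auto)

text \<open>The set J is separate from the running events so that clocks can be added one at a time,
  and so that all running clocks but one can be required to last.\<close>

definition hold_event :: "real \<Rightarrow> nat \<Rightarrow> 'v set \<Rightarrow> real \<Rightarrow> 'v event set \<Rightarrow> 'v clocks set" where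
  "hold_event t n A h J = {\<tau> \<in> space clock_space. at_step t n A \<tau> \<and> (\<forall>e\<in>J. t + h < due \<tau> n e)}"

lemma sets_hold_event [measurable]:
  assumes "J \<subseteq> \<E>" shows "hold_event t n A h J \<in> sets clock_space"
proof -
  have [measurable]: "Measurable.pred clock_space (\<lambda>\<tau>. \<forall>e\<in>J. t + h < due \<tau> n e)"
    using assms finite_subset[OF assms finite_events] by (intro pred_intros_finite) auto
  show ?thesis
    unfolding hold_event_def by measurable
qed

text \<open>Memorylessness, one clock at a time: with all other clocks fixed, the left and right events
  are \<open>\<tau> (m, e) > t - S + h\<close> and \<open>\<tau> (m, e) > t - S\<close>, where \<open>S\<close> is the time of step \<open>m\<close>.\<close>

lemma prob_hold_insert:
  assumes e: "e \<in> running G A" and J: "J \<subseteq> \<E>" "e \<notin> J" and "0 \<le> t" "0 \<le> h"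
  shows "prob (hold_event t n A h (insert e J)) = exp (- h * rate e) * prob (hold_event t n A h J)"
proof -
  have "e \<in> \<E>"
    using e running_subset by blast
  define D where "D m J = hold_event t n A h J \<inter> {\<tau> \<in> space clock_space. held \<tau> e m n}" for m J
  have sets_D: "D m J' \<in> sets clock_space" if "J' \<subseteq> \<E>" for m J'
    unfolding D_def using that by measurable
  have D: "prob (hold_event t n A h J') = (\<Sum>m\<le>n. prob (D m J'))" if "J' \<subseteq> \<E>" for J'
  proof -
    have "hold_event t n A h J' = (\<Union>m\<le>n. D m J')"
      unfolding D_def hold_event_def using at_step_held[OF _ e] by fastforce
    moreover have "disjoint_family_on (\<lambda>m. D m J') {..n}"
      using held_unique by (fastforce simp: disjoint_family_on_def D_def)
    ultimately show ?thesis
      using sets_D[OF that] by (simp add: finite_measure_finite_Union image_subset_iff)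
  qed
  have "prob (D m (insert e J)) = exp (- h * rate e) * prob (D m J)" for m
  proof (rule prob_coordinate_scale)
    show "(m, e) \<in> clock_index" using \<open>e \<in> \<E>\<close> by simp
    fix \<tau> assume \<tau>: "\<tau> \<in> space clock_space"
    have due_e: "due \<tau> n e = step_time \<tau> m + \<tau> (m, e)" if "\<tau> \<in> D m J" for \<tau>
      using that due_held[of m n e \<tau> n] by (auto simp: D_def held_def)
    have above: "t < step_time \<tau> m + \<tau> (m, e)" if "\<tau> \<in> D m J" for \<tau>
    proof -
      have "at_step t n A \<tau>"
        using that by (simp add: D_def hold_event_def)
      from at_step_due[OF this e] show ?thesis
        using due_e[OF that] by simp
    qed
    show "measure (clock_law (m, e)) {y. \<tau>((m, e) := y) \<in> D m (insert e J)} =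
      exp (- h * rate e) * measure (clock_law (m, e)) {y. \<tau>((m, e) := y) \<in> D m J}"
    proof (cases "\<exists>y. \<tau>((m, e) := y) \<in> D m J")
      case False
      then have "{y. \<tau>((m, e) := y) \<in> D m J} = {}" "{y. \<tau>((m, e) := y) \<in> D m (insert e J)} = {}"
        by (auto simp: D_def hold_event_def)
      then show ?thesis by (simp only: measure_empty mult_zero_right)
    next
      case True
      then obtain y0 where y0: "\<tau>((m, e) := y0) \<in> D m J" ..
      define \<tau>0 where "\<tau>0 = \<tau>((m, e) := y0)"
      \<comment> \<open>The start of the clock turns out to be constant on the slice, so it is read
        off at the reference point y0.\<close>
      define S where "S = step_time \<tau>0 m"
      have keep: "\<tau>((m, e) := y) \<in> D m J \<and> step_time (\<tau>((m, e) := y)) m = step_time (\<tau>((m, e) := y1)) m"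
        if "\<tau>((m, e) := y1) \<in> D m J" "t < step_time (\<tau>((m, e) := y1)) m + y" for y y1
      proof -
        let ?\<tau>1 = "\<tau>((m, e) := y1)"
        have "at_step t n A ?\<tau>1" "held ?\<tau>1 e m n"
          using that(1) by (auto simp: D_def hold_event_def)
        from replace_clock[OF this that(2)]
        have "at_step t n A (\<tau>((m, e) := y))" "held (\<tau>((m, e) := y)) e m n"
          "step_time (\<tau>((m, e) := y)) m = step_time ?\<tau>1 m"
          "\<And>e'. e' \<noteq> e \<Longrightarrow> due (\<tau>((m, e) := y)) n e' = due ?\<tau>1 n e'"
          by simp_all
        note upd = this
        have "t + h < due (\<tau>((m, e) := y)) n e'" if "e' \<in> J" for e'
        proof -
          have "e' \<noteq> e"
            using that J(2) by blast
          then show ?thesis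
            using upd(4)[of e'] that \<open>?\<tau>1 \<in> D m J\<close> by (simp add: D_def hold_event_def)
        qed
        then show ?thesis
          using upd(1-3) fun_upd_space_clock_space[OF \<tau> \<open>(m, e) \<in> clock_index\<close>, of y]
          by (simp add: D_def hold_event_def)
      qed
      have S: "step_time (\<tau>((m, e) := y)) m = S" if y: "\<tau>((m, e) := y) \<in> D m J" for y
      proof -
        \<comment> \<open>The value w exceeds both t - S and t minus the start seen from y. It is
          thus an admissible replacement from either point, and the two starts are compared at the
          common result.\<close>
        define w where "w = 1 + \<bar>t - S\<bar> + \<bar>t - step_time (\<tau>((m, e) := y)) m\<bar>"
        have "t < S + w" "t < step_time (\<tau>((m, e) := y)) m + w"
          unfolding w_def by linarith+
        then show ?thesis
          using keep[OF y0, of w] keep[OF y, of w] by (simp add: S_def \<tau>0_def)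
      qed
      have slice: "\<tau>((m, e) := y) \<in> D m J \<longleftrightarrow> t - S < y" for y
        using keep[OF y0, of y] above[of "\<tau>((m, e) := y)"] S[of y] by (auto simp: S_def \<tau>0_def)
      have slice': "\<tau>((m, e) := y) \<in> D m (insert e J) \<longleftrightarrow> t - S + h < y" for y
      proof -
        have "\<tau>((m, e) := y) \<in> D m (insert e J) \<longleftrightarrow>
          \<tau>((m, e) := y) \<in> D m J \<and> t + h < due (\<tau>((m, e) := y)) n e"
          by (auto simp: D_def hold_event_def)
        also have "\<dots> \<longleftrightarrow> \<tau>((m, e) := y) \<in> D m J \<and> t + h < S + y"
          using due_e[of "\<tau>((m, e) := y)"] S[of y] by auto
        also have "\<dots> \<longleftrightarrow> t - S + h < y"
          using slice[of y] \<open>0 \<le> h\<close> by auto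
        finally show ?thesis .
      qed
      \<comment> \<open>The tail formula needs a nonnegative argument t - S. For m = 0 this is
        \<open>0 \<le> t\<close>, otherwise step m is not after t.\<close>
      have "S \<le> t"
      proof -
        have "at_step t n A \<tau>0" "m \<le> n"
          using y0 by (auto simp: D_def hold_event_def held_def \<tau>0_def)
        then show ?thesis
          using at_step_less[of t n A \<tau>0 "m - 1"] \<open>0 \<le> t\<close>
          by (cases m) (auto simp: S_def step_time_def)
      qed
      have "{y. \<tau>((m, e) := y) \<in> D m J} = {t - S<..}"
        "{y. \<tau>((m, e) := y) \<in> D m (insert e J)} = {t - S + h<..}"
        using slice slice' by auto
      moreover have "exp (- (t - S + h) * rate e) = exp (- h * rate e) * exp (- (t - S) * rate e)"
        by (simp add: exp_add[symmetric] algebra_simps)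
      ultimately show ?thesis
        using measure_clock_greaterThan[OF \<open>e \<in> \<E>\<close>, of "t - S" m] \<open>S \<le> t\<close>
          measure_clock_greaterThan[OF \<open>e \<in> \<E>\<close>, of "t - S + h" m] \<open>0 \<le> h\<close>
        by simp
    qed
  qed (use sets_D J \<open>e \<in> \<E>\<close> in auto)
  note scale = this
  have "insert e J \<subseteq> \<E>"
    using J \<open>e \<in> \<E>\<close> by blast
  from D[OF this] show ?thesis
    unfolding D[OF J(1)] sum_distrib_left scale .
qed

lemma prob_hold:
  assumes "J \<subseteq> running G A" "0 \<le> t" "0 \<le> h"
  shows "prob (hold_event t n A h J) = exp (- h * sum rate J) * prob (hold_event t n A h {})"
proof -
  have "finite J"
    using assms(1) finite_subset by blast
  then show ?thesis
    using assms(1)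
  proof (induction J rule: finite_induct)
    case (insert e J)
    have "prob (hold_event t n A h (insert e J)) = exp (- h * rate e) * prob (hold_event t n A h J)"
      using insert assms running_subset by (intro prob_hold_insert) auto
    then show ?case
      using insert by (simp add: exp_add[symmetric] algebra_simps)
  qed simp
qed

end

subsection \<open>Lower bounds for short-time transitions\<close>

lemma one_minus_exp_ge: "x * (1 - x) \<le> 1 - exp (- x)" if "0 \<le> x" for x :: real
proof -
  have "exp (- x) \<le> 1 / (1 + x)"
    using exp_ge_add_one_self[of x] that by (simp add: exp_minus field_simps)
  \<comment> \<open>This is (1 + x) * (1 - x + x^2) = 1 + x^3.\<close>
  also have "\<dots> \<le> 1 - x * (1 - x)"
    using that by (simp add: field_simps power2_eq_square power3_eq_cube)
  finally show ?thesis by simp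
qed

lemma cube_one_minus_ge:
  fixes a b c y :: real
  assumes "0 \<le> a" "0 \<le> b" "0 \<le> c" "a \<le> y" "b \<le> y" "c \<le> y" "y \<le> 1"
  shows "1 - 3 * y \<le> (1 - a) * (1 - b) * (1 - c)"
proof -
  have "1 - 3 * y \<le> (1 - y) * (1 - y) * (1 - y)"
  proof -
    have "(1 - y) * (1 - y) * (1 - y) - (1 - 3 * y) = y * y * (3 - y)"
      by (simp add: algebra_simps)
    also have "\<dots> \<ge> 0"
      using assms by (intro mult_nonneg_nonneg) auto
    finally show ?thesis by simp
  qed
  also have "\<dots> \<le> (1 - a) * (1 - b) * (1 - c)"
    using assms by (intro mult_mono) auto
  finally show ?thesis .
qed

context propagation
begin

section \<open>The generator and lower bounds for its transitions\<close>

definition total_rate :: real where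
  "total_rate = sum rate \<E>"

text \<open>The rate matrix as a sum over events: several events may lead to the same U, and the
  diagonal becomes minus the exit rate because an enabled event always changes A.\<close>

definition generator :: "'v set \<Rightarrow> 'v set \<Rightarrow> real" where
  "generator A U = (\<Sum>e\<in>running G A. rate e * (of_bool (fire e A = U) - of_bool (A = U)))"

definition alive :: "real \<Rightarrow> 'v set \<Rightarrow> 'v clocks \<Rightarrow> bool" where
  "alive t A \<tau> \<longleftrightarrow> (\<exists>n. at_step t n A \<tau>)"

lemma pred_alive [measurable]: "Measurable.pred clock_space (alive t A)"
  unfolding alive_def by measurable

lemma rate_nonneg: "e \<in> \<E> \<Longrightarrow> 0 \<le> rate e"
  using rate_pos by (simp add: less_imp_le)

lemma sum_rate_le: "J \<subseteq> \<E> \<Longrightarrow> sum rate J \<le> total_rate"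
  unfolding total_rate_def using rate_nonneg by (intro sum_mono2) auto

lemma sum_rate_nonneg: "J \<subseteq> \<E> \<Longrightarrow> 0 \<le> sum rate J"
  using rate_nonneg by (intro sum_nonneg) auto

lemma rate_le: "e \<in> \<E> \<Longrightarrow> rate e \<le> total_rate"
  using sum_rate_le[of "{e}"] by simp

lemma total_rate_nonneg: "0 \<le> total_rate"
  using sum_rate_nonneg[of \<E>] by (simp add: total_rate_def)

lemma generator_self: "generator A A = - sum rate (running G A)"
proof -
  have "generator A A = (\<Sum>e\<in>running G A. - rate e)"
    unfolding generator_def using enabled_fire_neq
    by (intro sum.cong) (auto simp: running_def)
  then show ?thesis
    by (simp add: sum_negf)
qed

lemma generator_neq:
  assumes "A \<noteq> U"
  shows "generator A U = sum rate {e \<in> running G A. fire e A = U}"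
proof -
  have "generator A U = (\<Sum>e\<in>running G A. if fire e A = U then rate e else 0)"
    unfolding generator_def using assms by (intro sum.cong) auto
  then show ?thesis
    by (simp add: sum.inter_filter)
qed

lemma sum_generator:
  assumes "finite F"
  shows "(\<Sum>U\<in>F. generator A U) =
    (\<Sum>e\<in>running G A. rate e * (of_bool (fire e A \<in> F) - of_bool (A \<in> F)))"
proof -
  have *: "(\<Sum>U\<in>F. of_bool (B = U)) = (of_bool (B \<in> F) :: real)" for B
    using assms by (simp add: of_bool_def sum.delta)
  have "(\<Sum>U\<in>F. generator A U) =
    (\<Sum>e\<in>running G A. rate e * ((\<Sum>U\<in>F. of_bool (fire e A = U)) - (\<Sum>U\<in>F. of_bool (A = U))))"
    unfolding generator_def by (subst sum.swap) (simp only: sum_distrib_left right_diff_distrib sum_subtractf)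
  then show ?thesis
    unfolding * .
qed

lemma sum_generator_all: "A \<subseteq> V \<Longrightarrow> (\<Sum>U\<in>Pow V. generator A U) = 0"
proof -
  assume A: "A \<subseteq> V"
  have "fire e A \<in> Pow V" if "e \<in> running G A" for e
    using fire_nodes[OF _ A] that running_subset by blast
  then show ?thesis
    using A by (subst sum_generator) (auto intro!: sum.neutral)
qed

lemma hold_event_empty: "hold_event t n A h {} = {\<tau> \<in> space clock_space. at_step t n A \<tau>}"
  by (simp add: hold_event_def)

lemma prob_stay_ge:
  assumes "0 \<le> t" "0 \<le> h"
  shows "prob {\<tau> \<in> space clock_space. at_step t n A \<tau>} * (1 - h * sum rate (running G A))
    \<le> prob {\<tau> \<in> space clock_space. at_step t n A \<tau> \<and> alive (t + h) A \<tau>}"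
proof -
  have "prob {\<tau> \<in> space clock_space. at_step t n A \<tau>} * (1 - h * sum rate (running G A)) \<le>
    exp (- h * sum rate (running G A)) * prob {\<tau> \<in> space clock_space. at_step t n A \<tau>}"
    using exp_ge_add_one_self[of "- h * sum rate (running G A)"]
    by (subst mult.commute) (intro mult_right_mono, auto)
  also have "\<dots> = prob (hold_event t n A h (running G A))"
    using prob_hold[of "running G A" A t h n] assms by (simp add: hold_event_empty)
  also have "\<dots> \<le> prob {\<tau> \<in> space clock_space. at_step t n A \<tau> \<and> alive (t + h) A \<tau>}"
  proof (rule finite_measure_mono)
    have "at_step (t + h) n A \<tau>" if "\<tau> \<in> hold_event t n A h (running G A)" for \<tau>
      using that assms by (intro at_step_stay) (auto simp: hold_event_def)
    then show "hold_event t n A h (running G A) \<subseteq>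
        {\<tau> \<in> space clock_space. at_step t n A \<tau> \<and> alive (t + h) A \<tau>}"
      by (auto simp: hold_event_def alive_def)
  qed measurable
  finally show ?thesis .
qed

text \<open>All running clocks except e last beyond t + h and e does not. As a difference of nested
  events it gets its probability from \<open>prob_hold\<close> by subtraction.\<close>

definition jump_event :: "real \<Rightarrow> nat \<Rightarrow> 'v set \<Rightarrow> real \<Rightarrow> 'v event \<Rightarrow> 'v clocks set" where
  "jump_event t n A h e = hold_event t n A h (running G A - {e}) - hold_event t n A h (running G A)"

lemma sets_jump_event [measurable]: "jump_event t n A h e \<in> sets clock_space"
proof -
  have "running G A - {e} \<subseteq> \<E>"
    using running_subset by blast
  then show ?thesis
    unfolding jump_event_def using running_subset by (intro sets.Diff sets_hold_event)
qed

lemma prob_jump_event: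
  assumes "0 \<le> t" "0 \<le> h" and e: "e \<in> running G A"
  shows "prob (jump_event t n A h e) = exp (- h * sum rate (running G A - {e})) *
    (1 - exp (- h * rate e)) * prob {\<tau> \<in> space clock_space. at_step t n A \<tau>}"
proof -
  have sub: "running G A - {e} \<subseteq> \<E>"
    using running_subset by blast
  have "prob (jump_event t n A h e) =
    prob (hold_event t n A h (running G A - {e})) - prob (hold_event t n A h (running G A))"
    unfolding jump_event_def using running_subset sub
    by (intro finite_measure_Diff sets_hold_event) (auto simp: hold_event_def)
  also have "\<dots> = (exp (- h * sum rate (running G A - {e})) - exp (- h * sum rate (running G A))) *
      prob {\<tau> \<in> space clock_space. at_step t n A \<tau>}"
    using prob_hold[of "running G A" A t h n] prob_hold[of "running G A - {e}" A t h n] assms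
    by (simp add: hold_event_empty left_diff_distrib)
  also have "sum rate (running G A) = rate e + sum rate (running G A - {e})"
    using e by (intro sum.remove) auto
  finally show ?thesis
    by (simp add: exp_add[symmetric] algebra_simps)
qed

text \<open>A union bound handles the fresh clocks: each of them fails to exceed h with conditional
  probability at most h times its rate. The set X is exactly the scenario of
  \<open>at_step_jump\<close>.\<close>

lemma prob_jump_ge:
  fixes n :: nat
  assumes "0 \<le> t" "0 \<le> h" and e: "e \<in> running G A"
  defines "X \<equiv> {\<tau> \<in> jump_event t n A h e. \<forall>e'\<in>\<E>. h < \<tau> (Suc n, e')}"
  shows "X \<in> sets clock_space"
    and "prob {\<tau> \<in> space clock_space. at_step t n A \<tau>} * (rate e * h * (1 - 3 * total_rate * h)) \<le> prob X"
proof -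
  let ?W = "jump_event t n A h e"
  let ?b = "prob {\<tau> \<in> space clock_space. at_step t n A \<tau>}"
  define Y where "Y e' = {\<tau> \<in> ?W. h < \<tau> (Suc n, e')}" for e'
  have "e \<in> \<E>"
    using e running_subset by blast
  have W_space: "?W \<subseteq> space clock_space"
    by (auto simp: jump_event_def hold_event_def)
  have Y_sets: "Y e' \<in> sets clock_space" if "e' \<in> \<E>" for e'
  proof -
    have "(\<lambda>\<tau>. \<tau> (Suc n, e')) \<in> borel_measurable clock_space"
      using that by simp
    then have "{\<tau> \<in> space clock_space. h < \<tau> (Suc n, e')} \<in> sets clock_space"
      by (simp add: borel_measurable_iff_greater)
    moreover have "Y e' = ?W \<inter> {\<tau> \<in> space clock_space. h < \<tau> (Suc n, e')}"
      using W_space by (auto simp: Y_def)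
    ultimately show ?thesis
      by simp
  qed
  have X: "X = ?W - (\<Union>e'\<in>\<E>. ?W - Y e')"
    by (auto simp: X_def Y_def)
  show "X \<in> sets clock_space"
    unfolding X using Y_sets by (intro sets.Diff sets.finite_UN) auto
  \<comment> \<open>Being at step n and the due times at step n depend on the clocks of steps 0 to n
    only.\<close>
  have inv: "\<tau>((Suc n, e') := y) \<in> ?W \<longleftrightarrow> \<tau> \<in> ?W" if "\<tau> \<in> space clock_space" "e' \<in> \<E>" for \<tau> e' y
  proof -
    let ?\<tau> = "\<tau>((Suc n, e') := y)"
    have "?\<tau> \<in> space clock_space"
      using fun_upd_space_clock_space that by simp
    moreover have "at_step t n A ?\<tau> = at_step t n A \<tau>" "\<And>e. e \<in> \<E> \<Longrightarrow> due ?\<tau> n e = due \<tau> n e"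
      using at_step_fresh[of n ?\<tau> \<tau>] by auto
    ultimately show ?thesis
      using that(1) running_subset[of A] by (auto simp: jump_event_def hold_event_def subset_iff)
  qed
  have Y_prob: "prob (?W - Y e') \<le> h * rate e' * prob ?W" if "e' \<in> \<E>" for e'
  proof -
    have "prob (Y e') = exp (- h * rate e') * prob ?W"
      unfolding Y_def using that inv assms by (intro prob_fresh) auto
    moreover have "prob (?W - Y e') = prob ?W - prob (Y e')"
      using Y_sets[OF that] by (intro finite_measure_Diff) (auto simp: Y_def)
    ultimately have "prob (?W - Y e') = (1 - exp (- h * rate e')) * prob ?W"
      by (simp add: left_diff_distrib)
    also have "\<dots> \<le> h * rate e' * prob ?W"
      using exp_ge_add_one_self[of "- h * rate e'"] by (intro mult_right_mono) auto
    finally show ?thesis .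
  qed
  have "prob (\<Union>e'\<in>\<E>. ?W - Y e') \<le> (\<Sum>e'\<in>\<E>. prob (?W - Y e'))"
    using Y_sets by (intro finite_measure_subadditive_finite) auto
  also have "\<dots> \<le> (\<Sum>e'\<in>\<E>. h * rate e' * prob ?W)"
    by (intro sum_mono Y_prob)
  also have "\<dots> = h * total_rate * prob ?W"
    by (simp add: total_rate_def sum_distrib_left sum_distrib_right)
  finally have "prob ?W * (1 - h * total_rate) \<le> prob ?W - prob (\<Union>e'\<in>\<E>. ?W - Y e')"
    by (simp add: algebra_simps)
  also have "\<dots> = prob X"
    unfolding X using Y_sets
    by (intro finite_measure_Diff[symmetric] sets.finite_UN sets.Diff) auto
  finally have X_ge: "prob ?W * (1 - h * total_rate) \<le> prob X" .
  let ?s = "sum rate (running G A - {e})"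
  have s: "0 \<le> ?s" "?s \<le> total_rate"
    using running_subset by (auto intro!: sum_rate_nonneg sum_rate_le)
  have re: "0 \<le> rate e" "rate e \<le> total_rate"
    using rate_nonneg rate_le \<open>e \<in> \<E>\<close> by auto
  show "?b * (rate e * h * (1 - 3 * total_rate * h)) \<le> prob X"
  \<comment> \<open>For larger h the claimed lower bound is at most 0.\<close>
  proof (cases "total_rate * h \<le> 1")
    case False
    then have "?b * (rate e * h * (1 - 3 * total_rate * h)) \<le> 0"
      using re assms by (intro mult_nonneg_nonpos) auto
    then show ?thesis
      by (rule order_trans) simp
  next
    case True
    have bounds: "?s * h \<le> total_rate * h" "rate e * h \<le> total_rate * h"
      using s re assms by (auto intro: mult_right_mono)
    have "1 - 3 * (total_rate * h) \<le> (1 - ?s * h) * (1 - rate e * h) * (1 - total_rate * h)"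
      using bounds True s re assms total_rate_nonneg by (intro cube_one_minus_ge) auto
    then have "?b * (rate e * h * (1 - 3 * total_rate * h)) \<le>
      ?b * (rate e * h * ((1 - ?s * h) * (1 - rate e * h) * (1 - total_rate * h)))"
      using re assms by (intro mult_left_mono) (auto simp: algebra_simps)
    also have "\<dots> = (1 - ?s * h) * ((rate e * h) * (1 - rate e * h)) * ?b * (1 - h * total_rate)"
      by (simp add: algebra_simps)
    also have "\<dots> \<le> exp (- h * ?s) * (1 - exp (- h * rate e)) * ?b * (1 - h * total_rate)"
    proof (intro mult_right_mono mult_mono)
      show "1 - ?s * h \<le> exp (- h * ?s)"
        using exp_ge_add_one_self[of "- h * ?s"] by (simp add: mult.commute)
      show "rate e * h * (1 - rate e * h) \<le> 1 - exp (- h * rate e)"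
        using one_minus_exp_ge[of "rate e * h"] re assms by (simp add: mult.commute)
      show "0 \<le> rate e * h * (1 - rate e * h)"
        using re assms bounds True by (intro mult_nonneg_nonneg) auto
      show "0 \<le> 1 - h * total_rate"
        using True by (simp add: mult.commute)
    qed auto
    also have "\<dots> = prob ?W * (1 - h * total_rate)"
      by (simp add: prob_jump_event assms(1,2) e)
    also have "\<dots> \<le> prob X"
      by (rule X_ge)
    finally show ?thesis .
  qed
qed

text \<open>For A = U staying alone gives the bound. Otherwise the scenarios of the events leading
  from A to U are disjoint, since in each of them a single clock rings, and their probabilities add
  up to the generator entry.\<close>

lemma prob_step_ge:
  assumes "0 \<le> t" "0 \<le> h"
  shows "prob {\<tau> \<in> space clock_space. at_step t n A \<tau>} *
      (of_bool (A = U) + h * generator A U - 3 * total_rate\<^sup>2 * h\<^sup>2)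
    \<le> prob {\<tau> \<in> space clock_space. at_step t n A \<tau> \<and> alive (t + h) U \<tau>}"
proof (cases "A = U")
  case True
  have "prob {\<tau> \<in> space clock_space. at_step t n A \<tau>} *
      (of_bool (A = U) + h * generator A U - 3 * total_rate\<^sup>2 * h\<^sup>2)
    \<le> prob {\<tau> \<in> space clock_space. at_step t n A \<tau>} * (1 - h * sum rate (running G A))"
    using True by (intro mult_left_mono) (auto simp: generator_self)
  also have "\<dots> \<le> prob {\<tau> \<in> space clock_space. at_step t n A \<tau> \<and> alive (t + h) U \<tau>}"
    using prob_stay_ge[OF assms] True by simp
  finally show ?thesis .
next
  case False
  let ?b = "prob {\<tau> \<in> space clock_space. at_step t n A \<tau>}"
  let ?R = "{e \<in> running G A. fire e A = U}"
  define X where "X e = {\<tau> \<in> jump_event t n A h e. \<forall>e'\<in>\<E>. h < \<tau> (Suc n, e')}" for e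
  have R: "?R \<subseteq> \<E>"
    using running_subset by blast
  have X: "X e \<in> sets clock_space" "?b * (rate e * h * (1 - 3 * total_rate * h)) \<le> prob (X e)"
    if "e \<in> ?R" for e
    using prob_jump_ge[of t h e A n] that assms by (auto simp: X_def)
  have rings: "due \<tau> n e \<le> t + h" "\<And>e'. e' \<in> running G A \<Longrightarrow> e' \<noteq> e \<Longrightarrow> t + h < due \<tau> n e'"
    if "\<tau> \<in> X e" for \<tau> e
  proof -
    have others: "\<forall>e'\<in>running G A - {e}. t + h < due \<tau> n e'"
      and "\<not> (\<forall>e'\<in>running G A. t + h < due \<tau> n e')"
      using that by (auto simp: X_def jump_event_def hold_event_def)
    then show "due \<tau> n e \<le> t + h"
      by (metis DiffI not_less singletonD)
    show "\<And>e'. e' \<in> running G A \<Longrightarrow> e' \<noteq> e \<Longrightarrow> t + h < due \<tau> n e'"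
      using others by blast
  qed
  have disj: "disjoint_family_on X ?R"
    unfolding disjoint_family_on_def
  proof (intro ballI impI)
    fix e e' assume e: "e \<in> ?R" "e' \<in> ?R" "e \<noteq> e'"
    show "X e \<inter> X e' = {}"
    proof (rule equals0I)
      fix \<tau> assume "\<tau> \<in> X e \<inter> X e'"
      then have "due \<tau> n e \<le> t + h" "t + h < due \<tau> n e"
        using rings(1)[of \<tau> e] rings(2)[of \<tau> e' e] e by auto
      then show False by simp
    qed
  qed
  \<comment> \<open>Of the two factors \<open>total_rate\<close> in the error, one bounds the rates
    leading to U and the other comes from the relative error in \<open>prob_jump_ge\<close>.\<close>
  have "sum rate ?R * h * (total_rate * h) \<le> total_rate * h * (total_rate * h)"
    using sum_rate_le[OF R] total_rate_nonneg assms by (intro mult_right_mono) auto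
  then have "of_bool (A = U) + h * generator A U - 3 * total_rate\<^sup>2 * h\<^sup>2 \<le>
    sum rate ?R * (h * (1 - 3 * total_rate * h))"
    using False by (simp add: generator_neq power2_eq_square algebra_simps)
  then have "?b * (of_bool (A = U) + h * generator A U - 3 * total_rate\<^sup>2 * h\<^sup>2)
    \<le> ?b * (sum rate ?R * (h * (1 - 3 * total_rate * h)))"
    by (intro mult_left_mono) auto
  also have "\<dots> = (\<Sum>e\<in>?R. ?b * (rate e * h * (1 - 3 * total_rate * h)))"
    unfolding sum_distrib_right sum_distrib_left by (intro sum.cong) (auto simp: mult_ac)
  also have "\<dots> \<le> (\<Sum>e\<in>?R. prob (X e))"
    by (intro sum_mono X(2))
  also have "\<dots> = prob (\<Union>e\<in>?R. X e)"
    using X(1) disj by (intro finite_measure_finite_Union[symmetric]) auto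
  also have "\<dots> \<le> prob {\<tau> \<in> space clock_space. at_step t n A \<tau> \<and> alive (t + h) U \<tau>}"
  proof (rule finite_measure_mono)
    show "(\<Union>e\<in>?R. X e) \<subseteq> {\<tau> \<in> space clock_space. at_step t n A \<tau> \<and> alive (t + h) U \<tau>}"
    proof
      fix \<tau> assume "\<tau> \<in> (\<Union>e\<in>?R. X e)"
      then obtain e where e: "e \<in> running G A" "fire e A = U" "\<tau> \<in> X e"
        by auto
      then have at: "at_step t n A \<tau>" "\<tau> \<in> space clock_space" "\<And>e'. e' \<in> \<E> \<Longrightarrow> h < \<tau> (Suc n, e')"
        by (auto simp: X_def jump_event_def hold_event_def)
      have "at_step (t + h) (Suc n) (fire e A) \<tau>"
        by (rule at_step_jump[OF at(1) assms(2) e(1) rings(1)[OF e(3)] rings(2)[OF e(3)] at(3)])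
      then show "\<tau> \<in> {\<tau> \<in> space clock_space. at_step t n A \<tau> \<and> alive (t + h) U \<tau>}"
        using at e by (auto simp: alive_def)
    qed
  qed measurable
  finally show ?thesis .
qed

lemma prob_alive_ge:
  assumes "0 \<le> t" "0 \<le> h"
  shows "prob {\<tau> \<in> space clock_space. alive t A \<tau>} *
      (of_bool (A = U) + h * generator A U - 3 * total_rate\<^sup>2 * h\<^sup>2)
    \<le> prob {\<tau> \<in> space clock_space. alive t A \<tau> \<and> alive (t + h) U \<tau>}"
proof (rule sums_le)
  have disj: "disjoint_family (\<lambda>n. {\<tau> \<in> space clock_space. at_step t n A \<tau> \<and> Q \<tau>})" for Q
    using at_step_unique(1) by (fastforce simp: disjoint_family_on_def)
  \<comment> \<open>The conjunct \<open>True\<close> lets one disjointness fact serve both series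
    over n.\<close>
  have "(\<lambda>n. prob {\<tau> \<in> space clock_space. at_step t n A \<tau> \<and> True}) sums
    prob (\<Union>n. {\<tau> \<in> space clock_space. at_step t n A \<tau> \<and> True})"
    by (intro finite_measure_UNION disj) auto
  also have "(\<Union>n. {\<tau> \<in> space clock_space. at_step t n A \<tau> \<and> True}) = {\<tau> \<in> space clock_space. alive t A \<tau>}"
    by (auto simp: alive_def)
  finally show "(\<lambda>n. prob {\<tau> \<in> space clock_space. at_step t n A \<tau>} *
      (of_bool (A = U) + h * generator A U - 3 * total_rate\<^sup>2 * h\<^sup>2)) sums
    (prob {\<tau> \<in> space clock_space. alive t A \<tau>} *
      (of_bool (A = U) + h * generator A U - 3 * total_rate\<^sup>2 * h\<^sup>2))"
    by (intro sums_mult2) simp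
  have "(\<lambda>n. prob {\<tau> \<in> space clock_space. at_step t n A \<tau> \<and> alive (t + h) U \<tau>}) sums
    prob (\<Union>n. {\<tau> \<in> space clock_space. at_step t n A \<tau> \<and> alive (t + h) U \<tau>})"
    by (intro finite_measure_UNION disj) auto
  also have "(\<Union>n. {\<tau> \<in> space clock_space. at_step t n A \<tau> \<and> alive (t + h) U \<tau>}) =
    {\<tau> \<in> space clock_space. alive t A \<tau> \<and> alive (t + h) U \<tau>}"
    by (auto simp: alive_def)
  finally show "(\<lambda>n. prob {\<tau> \<in> space clock_space. at_step t n A \<tau> \<and> alive (t + h) U \<tau>}) sums
    prob {\<tau> \<in> space clock_space. alive t A \<tau> \<and> alive (t + h) U \<tau>}" .
qed (rule prob_step_ge[OF assms])

end

subsection \<open>Non-explosion and the forward equation\<close>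

text \<open>Since probabilities add up to 1, lower bounds for transition probabilities suffice: they imply
  the upper bounds.\<close>

lemma abs_diff_le_of_lower_bounds:
  fixes x l :: "'a \<Rightarrow> real" and d :: real
  assumes "finite F" "u \<in> F" and lower: "\<And>v. v \<in> F \<Longrightarrow> l v - d \<le> x v"
    and "sum x F \<le> sum l F" "0 \<le> d"
  shows "\<bar>x u - l u\<bar> \<le> card F * d"
proof -
  have "sum (\<lambda>v. l v - d) (F - {u}) \<le> sum x (F - {u})"
    using lower by (intro sum_mono) auto
  moreover have "sum x F = x u + sum x (F - {u})" "sum l F = l u + sum l (F - {u})"
    using assms by (auto intro: sum.remove)
  ultimately have "x u - l u \<le> card (F - {u}) * d"
    using assms(4) by (simp add: sum_subtractf)
  also have "\<dots> \<le> card F * d"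
    using assms by (intro mult_right_mono) (auto intro: card_mono)
  finally have "x u - l u \<le> card F * d" .
  moreover have "1 * d \<le> card F * d"
    using assms card_gt_0_iff[of F] by (intro mult_right_mono) (auto simp: Suc_leI)
  ultimately show ?thesis
    using lower[OF assms(2)] by linarith
qed

text \<open>Forward increments also control points s < t: the estimate is applied from s, with the
  same B and L.\<close>

lemma continuous_on_of_increment:
  fixes f d :: "real \<Rightarrow> real"
  assumes inc: "\<And>t h. 0 \<le> t \<Longrightarrow> 0 \<le> h \<Longrightarrow> \<bar>f (t + h) - f t - h * d t\<bar> \<le> B * h\<^sup>2"
    and bound: "\<And>t. 0 \<le> t \<Longrightarrow> \<bar>d t\<bar> \<le> L"
  shows "continuous_on {0..} f"
  unfolding continuous_on_def
proof
  fix t :: real assume t: "t \<in> {0..}"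
  have step: "\<bar>f (s + h) - f s\<bar> \<le> L * h + B * h\<^sup>2" if "0 \<le> s" "0 \<le> h" for s h
  proof -
    have "\<bar>h * d s\<bar> \<le> L * h"
      using bound[OF that(1)] that(2) by (simp add: abs_mult mult.commute[of h] mult_right_mono)
    then show ?thesis
      using inc[OF that] by linarith
  qed
  have "((\<lambda>s. f s - f t) \<longlongrightarrow> 0) (at t within {0..})"
  proof (rule Lim_null_comparison)
    show "\<forall>\<^sub>F s in at t within {0..}. norm (f s - f t) \<le> L * \<bar>s - t\<bar> + B * \<bar>s - t\<bar>\<^sup>2"
      unfolding eventually_at_filter
    proof (intro always_eventually allI impI)
      fix s :: real assume "s \<noteq> t" "s \<in> {0..}"
      then show "norm (f s - f t) \<le> L * \<bar>s - t\<bar> + B * \<bar>s - t\<bar>\<^sup>2"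
        using step[of t "s - t"] step[of s "t - s"] t by (cases "t \<le> s") auto
    qed
    have "((\<lambda>s. L * \<bar>s - t\<bar> + B * \<bar>s - t\<bar>\<^sup>2) \<longlongrightarrow> L * \<bar>t - t\<bar> + B * \<bar>t - t\<bar>\<^sup>2) (at t within {0..})"
      by (intro tendsto_intros)
    then show "((\<lambda>s. L * \<bar>s - t\<bar> + B * \<bar>s - t\<bar>\<^sup>2) \<longlongrightarrow> 0) (at t within {0..})"
      by simp
  qed
  then show "(f \<longlongrightarrow> f t) (at t within {0..})"
    by (simp add: LIM_zero_iff)
qed

text \<open>From the left, the increment from s to t has slope close to d s rather than d t;
  continuity of d closes the gap.\<close>

lemma has_real_derivative_of_increment:
  fixes f d :: "real \<Rightarrow> real"
  assumes inc: "\<And>t h. 0 \<le> t \<Longrightarrow> 0 \<le> h \<Longrightarrow> \<bar>f (t + h) - f t - h * d t\<bar> \<le> B * h\<^sup>2"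
    and cont: "continuous_on {0..} d" and t: "0 \<le> t"
  shows "(f has_real_derivative d t) (at t within {0..})"
  unfolding has_field_derivative_iff
proof -
  have slope: "\<bar>(f (s + h) - f s) / h - d s\<bar> \<le> B * h" if "0 \<le> s" "0 < h" for s h
  proof -
    have "\<bar>(f (s + h) - f s) / h - d s\<bar> = \<bar>f (s + h) - f s - h * d s\<bar> / h"
      using that by (simp add: field_simps abs_divide)
    also have "\<dots> \<le> B * h\<^sup>2 / h"
      using inc[of s h] that by (intro divide_right_mono) auto
    finally show ?thesis
      using that by (simp add: power2_eq_square)
  qed
  have "((\<lambda>s. (f s - f t) / (s - t) - d t) \<longlongrightarrow> 0) (at t within {0..})"
  proof (rule Lim_null_comparison)
    show "\<forall>\<^sub>F s in at t within {0..}.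
      norm ((f s - f t) / (s - t) - d t) \<le> B * \<bar>s - t\<bar> + \<bar>d s - d t\<bar>"
      unfolding eventually_at_filter
    proof (intro always_eventually allI impI)
      fix s :: real assume s: "s \<noteq> t" "s \<in> {0..}"
      show "norm ((f s - f t) / (s - t) - d t) \<le> B * \<bar>s - t\<bar> + \<bar>d s - d t\<bar>"
      proof (cases "t < s")
        case True
        then show ?thesis
          using slope[of t "s - t"] t by simp
      next
        case False
        moreover have "(f t - f s) / (t - s) = (f s - f t) / (s - t)"
          by (metis minus_diff_eq minus_divide_divide)
        ultimately show ?thesis
          using slope[of s "t - s"] s by simp
      qed
    qed
    have "(d \<longlongrightarrow> d t) (at t within {0..})"
      using cont t by (simp add: continuous_on_def)
    then have "((\<lambda>s. B * \<bar>s - t\<bar> + \<bar>d s - d t\<bar>) \<longlongrightarrow> B * \<bar>t - t\<bar> + \<bar>d t - d t\<bar>) (at t within {0..})"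
      by (intro tendsto_intros)
    then show "((\<lambda>s. B * \<bar>s - t\<bar> + \<bar>d s - d t\<bar>) \<longlongrightarrow> 0) (at t within {0..})"
      by simp
  qed
  then show "((\<lambda>s. (f s - f t) / (s - t)) \<longlongrightarrow> d t) (at t within {0..})"
    by (simp add: LIM_zero_iff)
qed

context propagation
begin

text \<open>The factor 3 comes from the three factors \<open>1 - total_rate * h\<close> lost in \<open>prob_jump_ge\<close>:
  to the other running clocks, to the second order term of \<open>1 - exp (- h * rate e)\<close>, and to the clocks
  started by the jump.\<close>

definition step_error :: real where
  "step_error = 3 * total_rate\<^sup>2"

lemma step_error_nonneg: "0 \<le> step_error"
  by (simp add: step_error_def)

section \<open>Conservation of mass\<close>

lemma sum_prob_le:
  assumes "finite F" "\<And>i. i \<in> F \<Longrightarrow> X i \<in> sets clock_space" "disjoint_family_on X F"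
    and "\<And>i. i \<in> F \<Longrightarrow> X i \<subseteq> Y" "Y \<in> sets clock_space"
  shows "(\<Sum>i\<in>F. prob (X i)) \<le> prob Y"
proof -
  have "(\<Sum>i\<in>F. prob (X i)) = prob (\<Union>i\<in>F. X i)"
    using assms by (intro finite_measure_finite_Union[symmetric]) auto
  also have "\<dots> \<le> prob Y"
    using assms by (intro finite_measure_mono) auto
  finally show ?thesis .
qed

lemma alive_unique: "alive t A \<tau> \<Longrightarrow> alive t B \<tau> \<Longrightarrow> A = B"
  unfolding alive_def using at_step_unique(2) by blast

lemma alive_active_set: "alive t A \<tau> \<Longrightarrow> active_set G coord t \<tau> = A"
  unfolding alive_def using at_step_active_set by blast

text \<open>The probability that some step lies beyond t, so that \<open>active_set\<close> is not a
  junk value; what is missing to 1 is the probability of explosion.\<close>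

definition mass :: "real \<Rightarrow> real" where
  "mass t = (\<Sum>A\<in>Pow V. prob {\<tau> \<in> space clock_space. alive t A \<tau>})"

lemma mass_le_1: "mass t \<le> 1"
proof -
  have "mass t \<le> prob (space clock_space)"
    unfolding mass_def using alive_unique
    by (intro sum_prob_le) (auto simp: disjoint_family_on_def)
  then show ?thesis
    by (simp add: prob_space)
qed

text \<open>The rows of I + h Q sum to 1 because those of Q sum to 0. This supplies the matching
  totals in every squeeze below.\<close>

lemma sum_transition:
  assumes "A \<subseteq> V"
  shows "(\<Sum>U\<in>Pow V. of_bool (A = U) + h * generator A U) = 1"
  using assms
  by (simp add: sum.distrib sum_distrib_left[symmetric] sum_generator_all of_bool_def sum.delta)

text \<open>Summed over all targets U, the main terms of the lower bounds return the whole mass of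
  A; only one error term per target is lost.\<close>

lemma mass_step:
  assumes "0 \<le> t" "0 \<le> h"
  shows "mass t - card (Pow V) * step_error * h\<^sup>2 \<le> mass (t + h)"
proof -
  let ?a = "\<lambda>A. prob {\<tau> \<in> space clock_space. alive t A \<tau>}"
  let ?e = "card (Pow V) * step_error * h\<^sup>2"
  \<comment> \<open>Since the mass is at most 1, the loss becomes additive with a constant
    independent of t and can be accumulated along a grid.\<close>
  have "mass t * ?e \<le> 1 * ?e"
    using mass_le_1 step_error_nonneg by (intro mult_right_mono) auto
  then have "mass t - ?e \<le> mass t * (1 - ?e)"
    by (simp add: algebra_simps)
  also have "\<dots> = (\<Sum>A\<in>Pow V. ?a A * (1 - ?e))"
    by (simp add: mass_def sum_distrib_right)
  also have "\<dots> = (\<Sum>A\<in>Pow V. \<Sum>U\<in>Pow V. ?a A * (of_bool (A = U) + h * generator A U - step_error * h\<^sup>2))"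
  proof (rule sum.cong)
    fix A assume "A \<in> Pow V"
    then have "1 - ?e = (\<Sum>U\<in>Pow V. of_bool (A = U) + h * generator A U - step_error * h\<^sup>2)"
      using sum_transition[of A h] by (simp add: sum_subtractf)
    then show "?a A * (1 - ?e) =
      (\<Sum>U\<in>Pow V. ?a A * (of_bool (A = U) + h * generator A U - step_error * h\<^sup>2))"
      by (simp only: sum_distrib_left)
  qed simp
  also have "\<dots> \<le> (\<Sum>A\<in>Pow V. \<Sum>U\<in>Pow V. prob {\<tau> \<in> space clock_space. alive t A \<tau> \<and> alive (t + h) U \<tau>})"
    using prob_alive_ge[OF assms] by (intro sum_mono) (simp add: step_error_def)
  also have "\<dots> = (\<Sum>U\<in>Pow V. \<Sum>A\<in>Pow V. prob {\<tau> \<in> space clock_space. alive t A \<tau> \<and> alive (t + h) U \<tau>})"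
    by (rule sum.swap)
  also have "\<dots> \<le> mass (t + h)"
    unfolding mass_def using alive_unique
    by (intro sum_mono sum_prob_le) (auto simp: disjoint_family_on_def)
  finally show ?thesis .
qed

text \<open>At time 0 the initial clocks have to be strictly positive, which is almost sure by
  \<open>prob_fresh\<close> with h = 0.\<close>

lemma mass_0: "1 \<le> mass 0"
proof -
  have "AE \<tau> in clock_space. \<forall>e\<in>\<E>. 0 < \<tau> (0, e)"
  proof (rule AE_finite_allI)
    fix e assume e: "e \<in> \<E>"
    have "prob {\<tau> \<in> space clock_space. 0 < \<tau> (0, e)} = 1"
      using prob_fresh[OF e, of "space clock_space" 0 0] e fun_upd_space_clock_space by (simp add: prob_space)
    moreover have "{\<tau> \<in> space clock_space. 0 < \<tau> (0, e)} \<in> sets clock_space"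
      using measurable_clock[of "(0, e)"] e by (simp add: borel_measurable_iff_greater)
    ultimately show "AE \<tau> in clock_space. 0 < \<tau> (0, e)"
      by (rule prob_Collect_eq_1[THEN iffD1, rotated])
  qed simp
  moreover have "alive 0 (source G) \<tau>" if "\<forall>e\<in>\<E>. 0 < \<tau> (0, e)" for \<tau>
    unfolding alive_def using that running_subset
    by (intro exI[of _ 0] at_stepI) (auto simp: act_0 due_0)
  ultimately have "AE \<tau> in clock_space. alive 0 (source G) \<tau>"
    by (auto elim: eventually_mono)
  then have "prob {\<tau> \<in> space clock_space. alive 0 (source G) \<tau>} = 1"
    by (subst prob_Collect_eq_1) auto
  moreover have "source G \<in> Pow V"
    using net by (simp add: propagation_network_def)
  then have "prob {\<tau> \<in> space clock_space. alive 0 (source G) \<tau>} \<le> mass 0"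
    unfolding mass_def by (intro member_le_sum) auto
  ultimately show ?thesis
    by simp
qed

text \<open>There are almost surely only finitely many steps up to time \<open>t\<close>: the probability lost
  in a time step of length \<open>t / n\<close> is of order \<open>1 / n\<^sup>2\<close>.\<close>

lemma mass_eq_1:
  assumes "0 \<le> t" shows "mass t = 1"
proof -
  let ?C = "card (Pow V) * step_error"
  have grid: "1 - j * (?C * h\<^sup>2) \<le> mass (j * h)" if "0 \<le> h" for h :: real and j :: nat
  proof (induction j)
    case 0
    then show ?case using mass_0 by simp
  next
    case (Suc j)
    then show ?case
      using mass_step[of "j * h" h] that by (simp add: algebra_simps)
  qed
  have "1 - ?C * t\<^sup>2 / Suc n \<le> mass t" for n
    using grid[of "t / Suc n" "Suc n"] assms by (simp add: power2_eq_square field_simps del: of_nat_Suc)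
  moreover have "(\<lambda>n. 1 - ?C * t\<^sup>2 / Suc n) \<longlonglongrightarrow> 1 - 0"
    by (intro tendsto_intros LIMSEQ_Suc lim_const_over_n)
  ultimately have "1 \<le> mass t"
    by (intro LIMSEQ_le_const2[where X = "\<lambda>n. 1 - ?C * t\<^sup>2 / Suc n"]) auto
  then show ?thesis
    using mass_le_1[of t] by simp
qed

section \<open>The law of the active set and its forward equation\<close>

definition state_prob :: "real \<Rightarrow> 'v set \<Rightarrow> real" where
  "state_prob t U = prob {\<tau> \<in> space clock_space. active_set G coord t \<tau> = U}"

definition joint :: "real \<Rightarrow> real \<Rightarrow> 'v set \<Rightarrow> 'v set \<Rightarrow> real" where
  "joint t h A U = prob {\<tau> \<in> space clock_space. active_set G coord t \<tau> = A \<and> active_set G coord (t + h) \<tau> = U}"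

lemma state_prob_nonneg: "0 \<le> state_prob t U"
  by (simp add: state_prob_def)

lemma sum_state_prob_le_1: "(\<Sum>U\<in>Pow V. state_prob t U) \<le> 1"
proof -
  have "(\<Sum>U\<in>Pow V. state_prob t U) \<le> prob (space clock_space)"
    unfolding state_prob_def by (intro sum_prob_le) (auto simp: disjoint_family_on_def)
  then show ?thesis
    by (simp add: prob_space)
qed

text \<open>Each event on the left is contained in the one on the right, and the left sides already
  sum to 1: the squeeze with error d = 0.\<close>

lemma prob_alive:
  assumes "0 \<le> t" "U \<subseteq> V"
  shows "prob {\<tau> \<in> space clock_space. alive t U \<tau>} = state_prob t U"
proof -
  have "\<bar>state_prob t U - prob {\<tau> \<in> space clock_space. alive t U \<tau>}\<bar> \<le> card (Pow V) * (0 :: real)"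
  proof (rule abs_diff_le_of_lower_bounds[where x = "state_prob t" and u = U
        and l = "\<lambda>U. prob {\<tau> \<in> space clock_space. alive t U \<tau>}"])
    show "(\<Sum>U\<in>Pow V. state_prob t U) \<le> (\<Sum>U\<in>Pow V. prob {\<tau> \<in> space clock_space. alive t U \<tau>})"
      using sum_state_prob_le_1 mass_eq_1[OF assms(1)] by (simp add: mass_def)
    show "prob {\<tau> \<in> space clock_space. alive t A \<tau>} - 0 \<le> state_prob t A" for A
      unfolding state_prob_def using alive_active_set by (auto intro!: finite_measure_mono)
  qed (use assms in auto)
  then show ?thesis
    by simp
qed

lemma sum_state_prob: "0 \<le> t \<Longrightarrow> (\<Sum>U\<in>Pow V. state_prob t U) = 1"
  using mass_eq_1[of t] prob_alive[of t] by (simp add: mass_def)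

lemma joint_ge:
  assumes "0 \<le> t" "0 \<le> h" "A \<subseteq> V"
  shows "state_prob t A * (of_bool (A = U) + h * generator A U) - state_prob t A * (step_error * h\<^sup>2) \<le> joint t h A U"
proof -
  have "state_prob t A * (of_bool (A = U) + h * generator A U - step_error * h\<^sup>2) \<le>
    prob {\<tau> \<in> space clock_space. alive t A \<tau> \<and> alive (t + h) U \<tau>}"
    using prob_alive_ge[OF assms(1,2), of A U] prob_alive assms by (simp add: step_error_def)
  also have "\<dots> \<le> joint t h A U"
    unfolding joint_def using alive_active_set by (intro finite_measure_mono) auto
  finally show ?thesis
    by (simp add: algebra_simps)
qed

text \<open>For fixed A the joint probabilities and their approximations have total at most,
  respectively equal to, \<open>state_prob t A\<close>, so the lower bounds of
  \<open>joint_ge\<close> suffice.\<close>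

lemma joint_approx:
  assumes "0 \<le> t" "0 \<le> h" "A \<subseteq> V" "U \<subseteq> V"
  shows "\<bar>joint t h A U - state_prob t A * (of_bool (A = U) + h * generator A U)\<bar>
    \<le> card (Pow V) * (state_prob t A * (step_error * h\<^sup>2))"
proof (rule abs_diff_le_of_lower_bounds[where x = "joint t h A" and u = U
      and l = "\<lambda>U. state_prob t A * (of_bool (A = U) + h * generator A U)"])
  have "(\<Sum>U\<in>Pow V. joint t h A U) \<le> state_prob t A"
    unfolding joint_def state_prob_def by (intro sum_prob_le) (auto simp: disjoint_family_on_def)
  also have "\<dots> = (\<Sum>U\<in>Pow V. state_prob t A * (of_bool (A = U) + h * generator A U))"
    by (simp only: sum_distrib_left[symmetric] sum_transition[OF assms(3)] mult_1_right)
  finally show "(\<Sum>U\<in>Pow V. joint t h A U) \<le>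
    (\<Sum>U\<in>Pow V. state_prob t A * (of_bool (A = U) + h * generator A U))" .
qed (use assms joint_ge state_prob_nonneg step_error_nonneg in auto)

text \<open>The right-hand side of the Kolmogorov forward equation: entry U of the row vector p(t)
  Q.\<close>

definition flow :: "real \<Rightarrow> 'v set \<Rightarrow> real" where
  "flow t U = (\<Sum>A\<in>Pow V. state_prob t A * generator A U)"

text \<open>Here the squeeze acts on the law at time t + h, whose total is 1. The error constant is
  independent of t, as differentiating from the left requires.\<close>

lemma state_prob_increment:
  assumes "0 \<le> t" "0 \<le> h" "U \<subseteq> V"
  shows "\<bar>state_prob (t + h) U - state_prob t U - h * flow t U\<bar> \<le> card (Pow V) * step_error * h\<^sup>2"
proof -
  have pt: "(\<Sum>A\<in>Pow V. state_prob t A * (of_bool (A = U) + h * generator A U)) = state_prob t U + h * flow t U"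
    if "U \<in> Pow V" for U
  proof -
    have "(\<Sum>A\<in>Pow V. state_prob t A * of_bool (A = U)) = (\<Sum>A\<in>Pow V. if A = U then state_prob t A else 0)"
      by (intro sum.cong) auto
    also have "\<dots> = state_prob t U"
      using that by (simp add: sum.delta')
    finally show ?thesis
      by (simp add: distrib_left sum.distrib flow_def sum_distrib_left mult_ac)
  qed
  have "\<bar>state_prob (t + h) U - (state_prob t U + h * flow t U)\<bar> \<le> card (Pow V) * (step_error * h\<^sup>2)"
  proof (rule abs_diff_le_of_lower_bounds[where x = "state_prob (t + h)" and u = U
        and l = "\<lambda>U. state_prob t U + h * flow t U"])
    have "(\<Sum>U\<in>Pow V. state_prob t U + h * flow t U) =
      (\<Sum>U\<in>Pow V. \<Sum>A\<in>Pow V. state_prob t A * (of_bool (A = U) + h * generator A U))"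
      using pt by (intro sum.cong) auto
    also have "\<dots> = (\<Sum>A\<in>Pow V. state_prob t A * (\<Sum>U\<in>Pow V. of_bool (A = U) + h * generator A U))"
      by (subst sum.swap) (simp only: sum_distrib_left)
    also have "\<dots> = 1"
      using sum_transition sum_state_prob[OF assms(1)] by simp
    finally show "(\<Sum>U\<in>Pow V. state_prob (t + h) U) \<le> (\<Sum>U\<in>Pow V. state_prob t U + h * flow t U)"
      using sum_state_prob[of "t + h"] assms by simp
    fix U assume U: "U \<in> Pow V"
    have "state_prob t U + h * flow t U - step_error * h\<^sup>2 =
      (\<Sum>A\<in>Pow V. state_prob t A * (of_bool (A = U) + h * generator A U) - state_prob t A * (step_error * h\<^sup>2))"
      using pt[OF U] sum_state_prob[OF assms(1)]
      by (simp add: sum_subtractf sum_distrib_right[symmetric])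
    also have "\<dots> \<le> (\<Sum>A\<in>Pow V. joint t h A U)"
      using joint_ge[OF assms(1,2)] by (intro sum_mono) auto
    also have "\<dots> \<le> state_prob (t + h) U"
      unfolding joint_def state_prob_def by (intro sum_prob_le) (auto simp: disjoint_family_on_def)
    finally show "state_prob t U + h * flow t U - step_error * h\<^sup>2 \<le> state_prob (t + h) U" .
  qed (use assms step_error_nonneg in auto)
  then show ?thesis
    by (simp add: algebra_simps)
qed

lemma abs_flow_le:
  assumes "0 \<le> t" shows "\<bar>flow t U\<bar> \<le> (\<Sum>A\<in>Pow V. \<bar>generator A U\<bar>)"
proof -
  have "state_prob t A \<le> 1" for A
    unfolding state_prob_def by simp
  then have "\<bar>state_prob t A * generator A U\<bar> \<le> \<bar>generator A U\<bar>" for A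
    using state_prob_nonneg mult_right_mono[of "state_prob t A" 1 "\<bar>generator A U\<bar>"] by (simp add: abs_mult)
  then show ?thesis
    unfolding flow_def by (intro order_trans[OF sum_abs] sum_mono)
qed

text \<open>Bounded flow makes every \<open>state_prob\<close> continuous, hence also the flow, a
  finite linear combination of them.\<close>

lemma state_prob_has_derivative:
  assumes "0 \<le> t" "U \<subseteq> V"
  shows "((\<lambda>t. state_prob t U) has_real_derivative flow t U) (at t within {0..})"
proof (rule has_real_derivative_of_increment)
  have "continuous_on {0..} (\<lambda>t. state_prob t A)" if "A \<subseteq> V" for A
    using state_prob_increment that abs_flow_le by (intro continuous_on_of_increment)
  then show "continuous_on {0..} (\<lambda>t. flow t U)"
    unfolding flow_def by (intro continuous_intros) auto
qed (use state_prob_increment assms in auto)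


text \<open>Running events are sorted by their effect on the size; \<open>up_eq\<close> and
  \<open>down_eq\<close> identify the resulting rates with the sums over the graph.\<close>

definition up :: "'v set \<Rightarrow> real" where
  "up A = sum rate {e \<in> running G A. card (fire e A) = Suc (card A)}"

definition down :: "'v set \<Rightarrow> real" where
  "down A = sum rate {e \<in> running G A. Suc (card (fire e A)) = card A}"

subsection \<open>The number of active nodes\<close>

lemma card_fire:
  assumes "finite A" "enabled A e"
  shows "card (fire e A) = Suc (card A) \<longleftrightarrow> (\<forall>i. e \<noteq> Recover i)"
    and "Suc (card (fire e A)) = card A \<longleftrightarrow> (\<exists>i. e = Recover i)"
proof -
  have *: "card (fire e A) = Suc (card A) \<and> (\<forall>i. e \<noteq> Recover i) \<or>
    Suc (card (fire e A)) = card A \<and> (\<exists>i. e = Recover i)"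
  proof (cases e)
    case (Recover i)
    then show ?thesis
      using assms card_Suc_Diff1[of A i] by simp
  qed (use assms in simp_all)
  then show "card (fire e A) = Suc (card A) \<longleftrightarrow> (\<forall>i. e \<noteq> Recover i)"
    "Suc (card (fire e A)) = card A \<longleftrightarrow> (\<exists>i. e = Recover i)"
    by auto
qed

text \<open>Running transmissions are exactly the edges from A to V - A; all of these are possible
  events because edges have positive rate.\<close>

lemma up_eq:
  assumes "A \<subseteq> V"
  shows "up A = total_act G A + total_self G (V - A)"
proof -
  have fin: "finite A"
    using assms finite_subset by blast
  define N where "N i = out_nbrs G i \<inter> (V - A)" for i
  let ?T = "(\<lambda>(i, j). Transmit i j) ` (SIGMA i:A. N i)"
  let ?S = "Self_Activate ` {i \<in> V - A. 0 < self_rate G i}"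
  have edges: "edges G \<subseteq> V \<times> V" "\<And>i j. (i, j) \<in> edges G \<Longrightarrow> 0 < act_rate G i j"
    and self: "\<And>i. i \<in> V \<Longrightarrow> 0 \<le> self_rate G i"
    using net by (auto simp: propagation_network_def)
  have "e \<in> {e \<in> running G A. card (fire e A) = Suc (card A)} \<longleftrightarrow> e \<in> ?T \<union> ?S" for e
  proof -
    have "e \<in> {e \<in> running G A. card (fire e A) = Suc (card A)} \<longleftrightarrow>
        e \<in> running G A \<and> (\<forall>i. e \<noteq> Recover i)"
      using card_fire(1)[OF fin] by (auto simp: running_def)
    also have "\<dots> \<longleftrightarrow> e \<in> ?T \<union> ?S"
      using edges by (cases e) (auto simp: running_def possible_events_def N_def out_nbrs_def image_iff)
    finally show ?thesis .
  qed
  then have "up A = sum rate (?T \<union> ?S)"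
    unfolding up_def by (intro sum.cong) auto
  also have "\<dots> = sum rate ?T + sum rate ?S"
    using fin by (intro sum.union_disjoint) (auto simp: N_def)
  also have "sum rate ?T = (\<Sum>(i, j)\<in>(SIGMA i:A. N i). act_rate G i j)"
    by (subst sum.reindex) (auto simp: inj_on_def intro!: sum.cong)
  also have "\<dots> = total_act G A"
    unfolding total_act_def N_def using fin by (subst sum.Sigma) auto
  also have "sum rate ?S = (\<Sum>i\<in>{i \<in> V - A. 0 < self_rate G i}. self_rate G i)"
    by (subst sum.reindex) (auto simp: inj_on_def)
  \<comment> \<open>Self-activations of rate 0 have no clock; as summands they are 0 and can be put
    back.\<close>
  also have "\<dots> = total_self G (V - A)"
    unfolding total_self_def using self by (intro sum.mono_neutral_left) (auto simp: not_less intro: antisym)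
  finally show ?thesis .
qed

lemma down_eq:
  assumes "A \<subseteq> V"
  shows "down A = total_recov G A"
proof -
  have fin: "finite A"
    using assms finite_subset by blast
  let ?S = "Recover ` {i \<in> A. 0 < recov_rate G i}"
  have rec: "\<And>i. i \<in> V \<Longrightarrow> 0 \<le> recov_rate G i"
    using net by (auto simp: propagation_network_def)
  have "e \<in> {e \<in> running G A. Suc (card (fire e A)) = card A} \<longleftrightarrow> e \<in> ?S" for e
  proof -
    have "e \<in> {e \<in> running G A. Suc (card (fire e A)) = card A} \<longleftrightarrow>
        e \<in> running G A \<and> (\<exists>i. e = Recover i)"
      using card_fire(2)[OF fin] by (auto simp: running_def)
    also have "\<dots> \<longleftrightarrow> e \<in> ?S"
      using assms by (cases e) (auto simp: running_def possible_events_def image_iff)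
    finally show ?thesis .
  qed
  then have "down A = sum rate ?S"
    unfolding down_def by (intro sum.cong) auto
  also have "\<dots> = (\<Sum>i\<in>{i \<in> A. 0 < recov_rate G i}. recov_rate G i)"
    by (subst sum.reindex) (auto simp: inj_on_def)
  also have "\<dots> = total_recov G A"
    unfolding total_recov_def using rec assms fin
    by (intro sum.mono_neutral_left) (auto simp: not_less subset_iff intro: antisym)
  finally show ?thesis .
qed

section \<open>Lumping the states by size\<close>

lemma sets_of_size_subset: "U \<in> sets_of_size G k \<Longrightarrow> U \<subseteq> V"
  by (simp add: sets_of_size_def)

lemma finite_sets_of_size [simp]: "finite (sets_of_size G k)"
  using finite_subset[of "sets_of_size G k" "Pow V"] by (auto simp: sets_of_size_def)

lemma sum_sets_of_size: "(\<Sum>U\<in>sets_of_size G k. f U) = (\<Sum>U\<in>Pow V. f U * (of_bool (card U = k) :: real))"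
proof -
  have "sets_of_size G k = {U \<in> Pow V. card U = k}"
    by (auto simp: sets_of_size_def)
  then have "(\<Sum>U\<in>sets_of_size G k. f U) = (\<Sum>U\<in>Pow V. if card U = k then f U else 0)"
    by (simp only:) (rule sum.inter_filter, simp)
  also have "\<dots> = (\<Sum>U\<in>Pow V. f U * of_bool (card U = k))"
    by (intro sum.cong) auto
  finally show ?thesis .
qed

text \<open>Every running event changes the size by exactly one, so A contributes a gain if its size
  is next to k and a loss if it is k. The form \<open>Suc (card A) = k\<close> makes the gain from
  below vanish for k = 0.\<close>

lemma sum_generator_size:
  assumes "A \<subseteq> V"
  shows "(\<Sum>U\<in>sets_of_size G k. generator A U) =
    up A * (of_bool (Suc (card A) = k) - of_bool (card A = k)) +
    down A * (of_bool (card A = Suc k) - of_bool (card A = k))"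
proof -
  let ?R = "running G A"
  let ?u = "\<lambda>e. of_bool (card (fire e A) = Suc (card A)) :: real"
  let ?d = "\<lambda>e. of_bool (Suc (card (fire e A)) = card A) :: real"
  have fin: "finite A"
    using assms finite_subset by blast
  have "(\<Sum>U\<in>sets_of_size G k. generator A U) =
    (\<Sum>e\<in>?R. rate e * (of_bool (fire e A \<in> sets_of_size G k) - of_bool (A \<in> sets_of_size G k)))"
    by (rule sum_generator) simp
  also have "\<dots> = (\<Sum>e\<in>?R. rate e * ?u e * (of_bool (Suc (card A) = k) - of_bool (card A = k)) +
      rate e * ?d e * (of_bool (card A = Suc k) - of_bool (card A = k)))"
  proof (rule sum.cong)
    fix e assume e: "e \<in> ?R"
    then have "fire e A \<subseteq> V"
      using fire_nodes[OF _ assms] running_subset by blast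
    then have size: "fire e A \<in> sets_of_size G k \<longleftrightarrow> card (fire e A) = k"
      "A \<in> sets_of_size G k \<longleftrightarrow> card A = k"
      using assms by (auto simp: sets_of_size_def)
    have "enabled A e"
      using e by (simp add: running_def)
    from card_fire[OF fin this] consider
      "card (fire e A) = Suc (card A)" | "Suc (card (fire e A)) = card A"
      by blast
    then show "rate e * (of_bool (fire e A \<in> sets_of_size G k) - of_bool (A \<in> sets_of_size G k)) =
      rate e * ?u e * (of_bool (Suc (card A) = k) - of_bool (card A = k)) +
      rate e * ?d e * (of_bool (card A = Suc k) - of_bool (card A = k))"
      unfolding size by cases auto
  qed simp
  also have "\<dots> = (\<Sum>e\<in>?R. rate e * ?u e) * (of_bool (Suc (card A) = k) - of_bool (card A = k)) +
      (\<Sum>e\<in>?R. rate e * ?d e) * (of_bool (card A = Suc k) - of_bool (card A = k))"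
    by (simp only: sum.distrib sum_distrib_right)
  also have "(\<Sum>e\<in>?R. rate e * ?u e) = up A"
    unfolding up_def sum.inter_filter[OF finite_running] by (intro sum.cong) auto
  also have "(\<Sum>e\<in>?R. rate e * ?d e) = down A"
    unfolding down_def sum.inter_filter[OF finite_running] by (intro sum.cong) auto
  finally show ?thesis .
qed

text \<open>The flux q_k(t) \<rho>_k(t) before normalisation; the equations are derived for fluxes,
  as \<open>size_prob\<close> may vanish.\<close>

definition up_flow :: "nat \<Rightarrow> real \<Rightarrow> real" where
  "up_flow k t = (\<Sum>A\<in>sets_of_size G k. state_prob t A * up A)"

definition down_flow :: "nat \<Rightarrow> real \<Rightarrow> real" where
  "down_flow k t = (\<Sum>A\<in>sets_of_size G k. state_prob t A * down A)"

definition size_prob :: "nat \<Rightarrow> real \<Rightarrow> real" where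
  "size_prob k t = (\<Sum>A\<in>sets_of_size G k. state_prob t A)"

lemma sum_flow:
  "(\<Sum>U\<in>sets_of_size G k. flow t U) =
    (if k = 0 then 0 else up_flow (k - 1) t) - up_flow k t - down_flow k t + down_flow (Suc k) t"
proof -
  have "(\<Sum>U\<in>sets_of_size G k. flow t U) =
      (\<Sum>A\<in>Pow V. state_prob t A * (\<Sum>U\<in>sets_of_size G k. generator A U))"
    unfolding flow_def by (subst sum.swap) (simp only: sum_distrib_left)
  also have "\<dots> = (\<Sum>A\<in>Pow V. state_prob t A * up A * of_bool (Suc (card A) = k) -
      state_prob t A * up A * of_bool (card A = k) - state_prob t A * down A * of_bool (card A = k) +
      state_prob t A * down A * of_bool (card A = Suc k))"
    by (intro sum.cong) (simp_all add: sum_generator_size algebra_simps)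
  also have "\<dots> = (\<Sum>A\<in>Pow V. state_prob t A * up A * of_bool (Suc (card A) = k)) -
      up_flow k t - down_flow k t + down_flow (Suc k) t"
    by (simp only: sum.distrib sum_subtractf up_flow_def down_flow_def sum_sets_of_size)
  also have "(\<Sum>A\<in>Pow V. state_prob t A * up A * of_bool (Suc (card A) = k)) =
      (if k = 0 then 0 else up_flow (k - 1) t)"
    by (cases k) (simp_all add: up_flow_def sum_sets_of_size)
  finally show ?thesis .
qed

lemma size_prob_has_derivative:
  assumes "0 \<le> t"
  shows "(size_prob k has_real_derivative
    (if k = 0 then 0 else up_flow (k - 1) t) - up_flow k t - down_flow k t + down_flow (Suc k) t)
    (at t within {0..})"
  unfolding size_prob_def[abs_def] sum_flow[symmetric]
  using assms sets_of_size_subset by (intro DERIV_sum state_prob_has_derivative)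

lemma up_flow_nodes: "up_flow (card V) t = 0"
proof -
  have "sets_of_size G (card V) = {V}"
    by (auto simp: sets_of_size_def dest: card_subset_eq[OF finite_nodes])
  moreover have "up V = 0"
    using up_eq[of V] by (simp add: total_act_def total_self_def)
  ultimately show ?thesis
    by (simp add: up_flow_def)
qed

lemma sets_of_size_empty: "card V < k \<Longrightarrow> sets_of_size G k = {}"
  unfolding sets_of_size_def using card_mono[OF finite_nodes] leD by blast

lemma down_flow_0: "down_flow 0 t = 0"
  unfolding down_flow_def down_def
  by (intro sum.neutral ballI) (simp add: sets_of_size_def)

text \<open>This covers explosive \<tau> as well: if no index qualifies, \<open>LEAST\<close> is
  arbitrary, but no smaller index qualifies either. Hence sums over \<open>Pow V\<close> capture the
  whole probability.\<close>

lemma active_set_subset: "active_set G coord t \<tau> \<subseteq> V"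
proof -
  define m where "m = (LEAST n. ereal t < next_step \<tau> n)"
  have "act \<tau> m \<subseteq> V"
  proof (rule act_subset)
    fix k assume "k < m"
    then have "\<not> ereal t < next_step \<tau> k"
      unfolding m_def by (rule not_less_Least)
    then show "running G (act \<tau> k) \<noteq> {}"
      by (auto simp: next_step_eq)
  qed
  then show ?thesis
    by (simp add: active_set_def m_def act_def next_step_def)
qed

section \<open>Short-time limits for pairs of states and of sizes\<close>

lemma pred_active_set: "Measurable.pred clock_space (\<lambda>\<tau>. R (active_set G coord t \<tau>))"
  using measurable_compose[OF measurable_active_set[of t], of R "count_space UNIV"] by simp

lemma prob_active_set:
  "prob {\<tau> \<in> space clock_space. R (active_set G coord t \<tau>)} = (\<Sum>A\<in>{A \<in> Pow V. R A}. state_prob t A)"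
proof -
  have "{\<tau> \<in> space clock_space. R (active_set G coord t \<tau>)} =
      (\<Union>A\<in>{A \<in> Pow V. R A}. {\<tau> \<in> space clock_space. active_set G coord t \<tau> = A})"
    using active_set_subset by auto
  also have "prob \<dots> = (\<Sum>A\<in>{A \<in> Pow V. R A}. state_prob t A)"
    unfolding state_prob_def
  proof (rule finite_measure_finite_Union)
    have "{\<tau> \<in> space clock_space. active_set G coord t \<tau> = A} \<in> sets clock_space" for A
      using pred_active_set[of "\<lambda>B. B = A" t] by (rule predE)
    then show "(\<lambda>A. {\<tau> \<in> space clock_space. active_set G coord t \<tau> = A}) ` {A \<in> Pow V. R A} \<subseteq> sets clock_space"
      by blast
  qed (auto simp: disjoint_family_on_def)
  finally show ?thesis .
qed

lemma prob_active_set_pair: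
  "prob {\<tau> \<in> space clock_space. R (active_set G coord t \<tau>) \<and> S (active_set G coord (t + h) \<tau>)} =
    (\<Sum>A\<in>{A \<in> Pow V. R A}. \<Sum>U\<in>{U \<in> Pow V. S U}. joint t h A U)"
proof -
  let ?X = "\<lambda>(A, U). {\<tau> \<in> space clock_space. active_set G coord t \<tau> = A \<and> active_set G coord (t + h) \<tau> = U}"
  have eq: "{\<tau> \<in> space clock_space. R (active_set G coord t \<tau>) \<and> S (active_set G coord (t + h) \<tau>)} =
      (\<Union>i\<in>{A \<in> Pow V. R A} \<times> {U \<in> Pow V. S U}. ?X i)" (is "?L = ?R")
  proof (intro set_eqI iffI)
    fix \<tau> assume "\<tau> \<in> ?L"
    then show "\<tau> \<in> ?R"
      by (intro UN_I[of "(active_set G coord t \<tau>, active_set G coord (t + h) \<tau>)"])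
         (simp_all add: active_set_subset)
  next
    fix \<tau> assume "\<tau> \<in> ?R"
    then show "\<tau> \<in> ?L"
      by (elim UN_E SigmaE) simp
  qed
  have "prob {\<tau> \<in> space clock_space. R (active_set G coord t \<tau>) \<and> S (active_set G coord (t + h) \<tau>)} =
      (\<Sum>i\<in>{A \<in> Pow V. R A} \<times> {U \<in> Pow V. S U}. prob (?X i))"
    unfolding eq
  proof (rule finite_measure_finite_Union)
    have "{\<tau> \<in> space clock_space. active_set G coord t \<tau> = A \<and> active_set G coord (t + h) \<tau> = U} \<in> sets clock_space" for A U
      using pred_active_set[of "\<lambda>B. B = A" t] pred_active_set[of "\<lambda>B. B = U" "t + h"]
      by (intro pred_intros_logic predE)
    then show "?X ` ({A \<in> Pow V. R A} \<times> {U \<in> Pow V. S U}) \<subseteq> sets clock_space"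
      by (simp add: image_subset_iff case_prod_unfold)
  qed (auto simp: disjoint_family_on_def)
  also have "\<dots> = (\<Sum>(A, U)\<in>{A \<in> Pow V. R A} \<times> {U \<in> Pow V. S U}. joint t h A U)"
    by (intro sum.cong refl) (simp only: joint_def split_beta)
  also have "\<dots> = (\<Sum>A\<in>{A \<in> Pow V. R A}. \<Sum>U\<in>{U \<in> Pow V. S U}. joint t h A U)"
    by (rule sum.cartesian_product[symmetric])
  finally show ?thesis .
qed

text \<open>For A \<noteq> U the term of order 0 in \<open>joint_approx\<close> vanishes, and its
  error of order h^2 is still of order h after division.\<close>

lemma joint_rate:
  assumes "0 \<le> t" "A \<subseteq> V" "U \<subseteq> V" "A \<noteq> U"
  shows "((\<lambda>h. joint t h A U / h) \<longlongrightarrow> state_prob t A * generator A U) (at_right 0)"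
proof -
  define B where "B = card (Pow V) * (state_prob t A * step_error)"
  have "((\<lambda>h. joint t h A U / h - state_prob t A * generator A U) \<longlongrightarrow> 0) (at_right 0)"
  proof (rule Lim_null_comparison)
    show "\<forall>\<^sub>F h in at_right 0. norm (joint t h A U / h - state_prob t A * generator A U) \<le> B * h"
      unfolding eventually_at_filter
    proof (intro always_eventually allI impI)
      fix h :: real assume "h \<in> {0<..}"
      then have h: "0 < h" by simp
      have "norm (joint t h A U / h - state_prob t A * generator A U) =
          \<bar>joint t h A U - state_prob t A * (h * generator A U)\<bar> / h"
        using h by (simp add: field_simps abs_divide)
      also have "\<dots> \<le> B * h\<^sup>2 / h"
        using joint_approx[of t h A U] h assms
        by (intro divide_right_mono) (auto simp: B_def mult_ac)
      finally show "norm (joint t h A U / h - state_prob t A * generator A U) \<le> B * h"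
        using h by (simp add: power2_eq_square)
    qed
    have "((\<lambda>h. B * h) \<longlongrightarrow> B * 0) (at_right 0)"
      by (intro tendsto_intros)
    then show "((\<lambda>h. B * h) \<longlongrightarrow> 0) (at_right 0)"
      by simp
  qed
  then show ?thesis
    by (simp add: LIM_zero_iff)
qed

lemma joint_rate_sizes:
  assumes "0 \<le> t" "k \<noteq> l"
  shows "((\<lambda>h. (\<Sum>A\<in>sets_of_size G k. \<Sum>U\<in>sets_of_size G l. joint t h A U) / h) \<longlongrightarrow>
    (\<Sum>A\<in>sets_of_size G k. state_prob t A * (\<Sum>U\<in>sets_of_size G l. generator A U))) (at_right 0)"
  unfolding sum_divide_distrib sum_distrib_left
proof (intro tendsto_sum joint_rate assms(1))
  fix A U assume "A \<in> sets_of_size G k" "U \<in> sets_of_size G l"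
  then show "A \<subseteq> V" "U \<subseteq> V" "A \<noteq> U"
    using assms(2) by (auto simp: sets_of_size_def)
qed

end

subsection \<open>Arbitrary probability spaces\<close>

locale propagation_process = propagation G for G :: "'v network" +
  fixes M :: "'w measure" and T :: "nat \<Rightarrow> 'v event \<Rightarrow> 'w \<Rightarrow> real"
  assumes clocks: "propagation_clocks M G T"
begin

sublocale M: prob_space M
  using clocks by (simp add: propagation_clocks_def)

definition clock_family :: "'w \<Rightarrow> 'v clocks" where
  "clock_family \<omega> = (\<lambda>i\<in>clock_index. T (fst i) (snd i) \<omega>)"

lemma clock_distributed:
  "i \<in> clock_index \<Longrightarrow>
    distributed M lborel (T (fst i) (snd i)) (exponential_density (rate (snd i)))"
  using clocks by (auto simp: propagation_clocks_def)

lemma measurable_T: "i \<in> clock_index \<Longrightarrow> T (fst i) (snd i) \<in> borel_measurable M"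
  using distributed_measurable[OF clock_distributed, of i] by simp

lemma distr_T:
  assumes "i \<in> clock_index"
  shows "distr M borel (T (fst i) (snd i)) = clock_law i"
proof -
  have "distr M borel (T (fst i) (snd i)) = distr M lborel (T (fst i) (snd i))"
    by (rule distr_cong) auto
  also have "\<dots> = clock_law i"
    unfolding clock_law_def using clock_distributed[OF assms] by (rule distributed_distr_eq_density)
  finally show ?thesis .
qed

lemma measurable_clock_family [measurable]: "clock_family \<in> measurable M clock_space"
proof -
  have "clock_family \<in> measurable M (PiM clock_index (\<lambda>_. borel))"
    unfolding clock_family_def using measurable_T by (intro measurable_restrict) auto
  also have "measurable M (PiM clock_index (\<lambda>_. borel)) = measurable M clock_space"
    unfolding clock_space_def by (intro measurable_cong_sets refl sets_PiM_cong) auto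
  finally show ?thesis .
qed

lemma distr_clock_family: "distr M clock_space clock_family = clock_space"
\<comment> \<open>Independence is turned into a product law below for a nonempty index set; without
  possible events the clock space is a single point.\<close>
proof (cases "\<E> = {}")
  case True
  then have clock_space: "clock_space = count_space {\<lambda>_. undefined}"
    by (simp add: clock_space_def PiM_empty)
  show ?thesis
  proof (rule measure_eqI)
    fix X assume "X \<in> sets (distr M clock_space clock_family)"
    then have X: "X = {} \<or> X = space clock_space"
      using clock_space by auto
    interpret D: prob_space "distr M clock_space clock_family"
      by (rule M.prob_space_distr) measurable
    show "emeasure (distr M clock_space clock_family) X = emeasure clock_space X"
      using X D.emeasure_space_1 emeasure_space_1 by auto
  qed simp
next
  case False
  have "M.indep_vars (\<lambda>_. borel) (\<lambda>i. T (fst i) (snd i)) clock_index"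
    using clocks by (simp add: propagation_clocks_def case_prod_unfold)
  then have "distr M (PiM clock_index (\<lambda>_. borel)) clock_family =
      PiM clock_index (\<lambda>i. distr M borel (T (fst i) (snd i)))"
    unfolding clock_family_def using False measurable_T
    by (subst (asm) M.indep_vars_iff_distr_eq_PiM') auto
  also have "\<dots> = clock_space"
    unfolding clock_space_def by (rule PiM_cong) (simp_all add: distr_T)
  also have "distr M (PiM clock_index (\<lambda>_. borel)) clock_family = distr M clock_space clock_family"
    unfolding clock_space_def by (intro distr_cong refl sets_PiM_cong) auto
  finally show ?thesis .
qed

lemma active_set_clock_family: "active_set G T t \<omega> = active_set G coord t (clock_family \<omega>)"
  by (rule active_set_cong) (simp add: clock_family_def)

lemma prob_transfer:
  assumes "Measurable.pred clock_space Q"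
  shows "M.prob {\<omega> \<in> space M. Q (clock_family \<omega>)} = prob {\<tau> \<in> space clock_space. Q \<tau>}"
proof -
  have "prob {\<tau> \<in> space clock_space. Q \<tau>} = measure (distr M clock_space clock_family) {\<tau> \<in> space clock_space. Q \<tau>}"
    by (simp add: distr_clock_family)
  also have "\<dots> = M.prob (clock_family -` {\<tau> \<in> space clock_space. Q \<tau>} \<inter> space M)"
    using assms by (intro measure_distr) auto
  also have "clock_family -` {\<tau> \<in> space clock_space. Q \<tau>} \<inter> space M = {\<omega> \<in> space M. Q (clock_family \<omega>)}"
    using measurable_space[OF measurable_clock_family] by auto
  finally show ?thesis by simp
qed

lemma sizes_eq: "{A. A \<subseteq> V \<and> card A = k} = sets_of_size G k"
  by (auto simp: sets_of_size_def)

section \<open>Rates and equations on the given probability space\<close>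

lemma num_prob_eq: "num_prob M G T k t = size_prob k t"
  using prob_transfer[of "\<lambda>\<tau>. card (active_set G coord t \<tau>) = k"]
    prob_active_set[of "\<lambda>A. card A = k" t] pred_active_set[of "\<lambda>A. card A = k"]
  by (simp add: num_prob_def num_active_def active_set_clock_family size_prob_def sizes_eq)

lemma set_prob_eq:
  assumes "U \<in> sets_of_size G k"
  shows "set_prob M G T t U = state_prob t U / size_prob k t"
proof -
  have k: "card U = k"
    using assms by (simp add: sets_of_size_def)
  have "M.prob {\<omega> \<in> space M. active_set G T t \<omega> = U \<and> num_active G T t \<omega> = card U} =
      M.prob {\<omega> \<in> space M. active_set G coord t (clock_family \<omega>) = U}"
    by (rule arg_cong[where f = M.prob]) (auto simp: active_set_clock_family num_active_def)
  also have "\<dots> = state_prob t U"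
    unfolding state_prob_def by (intro prob_transfer pred_active_set)
  finally show ?thesis
    using num_prob_eq[of k t] k by (simp add: set_prob_def cond_prob_def num_prob_def)
qed

lemma prob_sizes:
  "M.prob {\<omega> \<in> space M. num_active G T (t + h) \<omega> = l \<and> num_active G T t \<omega> = k} =
    (\<Sum>A\<in>sets_of_size G k. \<Sum>U\<in>sets_of_size G l. joint t h A U)"
proof -
  have "M.prob {\<omega> \<in> space M. num_active G T (t + h) \<omega> = l \<and> num_active G T t \<omega> = k} =
    M.prob {\<omega> \<in> space M. card (active_set G coord t (clock_family \<omega>)) = k \<and>
      card (active_set G coord (t + h) (clock_family \<omega>)) = l}"
    by (rule arg_cong[where f = M.prob]) (auto simp: active_set_clock_family num_active_def)
  also have "\<dots> = prob {\<tau> \<in> space clock_space. card (active_set G coord t \<tau>) = k \<and>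
      card (active_set G coord (t + h) \<tau>) = l}"
    using pred_active_set[of "\<lambda>A. card A = k" t] pred_active_set[of "\<lambda>A. card A = l" "t + h"]
    by (intro prob_transfer) auto
  finally show ?thesis
    using prob_active_set_pair[of "\<lambda>A. card A = k" t "\<lambda>A. card A = l" h] by (simp add: sizes_eq)
qed

lemma up_quotient_eq:
  "up_quotient M G T k t h =
    (\<Sum>A\<in>sets_of_size G k. \<Sum>U\<in>sets_of_size G (Suc k). joint t h A U) / h / size_prob k t"
  using num_prob_eq[of k t] by (simp add: up_quotient_def cond_prob_def prob_sizes num_prob_def)

lemma down_quotient_eq:
  "down_quotient M G T (Suc k) t h =
    (\<Sum>A\<in>sets_of_size G (Suc k). \<Sum>U\<in>sets_of_size G k. joint t h A U) / h / size_prob (Suc k) t"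
  using num_prob_eq[of "Suc k" t] by (simp add: down_quotient_def cond_prob_def prob_sizes num_prob_def)

text \<open>From size k to k + 1 only the \<open>up\<close> part of
  \<open>sum_generator_size\<close> remains. If \<open>size_prob k t\<close> is 0, division by zero
  makes both the quotient and the limit 0.\<close>

lemma up_quotient_tendsto:
  assumes "0 \<le> t"
  shows "(up_quotient M G T k t \<longlongrightarrow> up_flow k t / size_prob k t) (at_right 0)"
proof -
  have "(\<Sum>A\<in>sets_of_size G k. state_prob t A * (\<Sum>U\<in>sets_of_size G (Suc k). generator A U)) = up_flow k t"
    unfolding up_flow_def
  proof (rule sum.cong)
    fix A assume "A \<in> sets_of_size G k"
    then have "card A = k" "A \<subseteq> V"
      by (simp_all add: sets_of_size_def)
    then show "state_prob t A * (\<Sum>U\<in>sets_of_size G (Suc k). generator A U) = state_prob t A * up A"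
      by (simp add: sum_generator_size)
  qed simp
  then show ?thesis
    using tendsto_mult_right[OF joint_rate_sizes[OF assms, of k "Suc k"], of "1 / size_prob k t"]
    unfolding up_quotient_eq[abs_def] by simp
qed

lemma down_quotient_tendsto:
  assumes "0 \<le> t"
  shows "(down_quotient M G T k t \<longlongrightarrow> down_flow k t / size_prob k t) (at_right 0)"
proof (cases k)
  \<comment> \<open>No successor equals 0, so the quotient is constantly 0, and so is the
    flux.\<close>
  case 0
  then show ?thesis
    by (simp add: down_flow_0 down_quotient_def[abs_def] cond_prob_def)
next
  case (Suc j)
  have "(\<Sum>A\<in>sets_of_size G (Suc j). state_prob t A * (\<Sum>U\<in>sets_of_size G j. generator A U)) =
      down_flow (Suc j) t"
    unfolding down_flow_def
  proof (rule sum.cong)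
    fix A assume "A \<in> sets_of_size G (Suc j)"
    then have "card A = Suc j" "A \<subseteq> V"
      by (simp_all add: sets_of_size_def)
    then show "state_prob t A * (\<Sum>U\<in>sets_of_size G j. generator A U) = state_prob t A * down A"
      by (simp add: sum_generator_size)
  qed simp
  then show ?thesis
    using tendsto_mult_right[OF joint_rate_sizes[OF assms, of "Suc j" j], of "1 / size_prob (Suc j) t"]
    unfolding Suc down_quotient_eq[abs_def] by simp
qed

lemma up_rate_eq: "0 \<le> t \<Longrightarrow> up_rate M G T k t = up_flow k t / size_prob k t"
  unfolding up_rate_def using up_quotient_tendsto by (intro tendsto_Lim) auto

lemma down_rate_eq: "0 \<le> t \<Longrightarrow> down_rate M G T k t = down_flow k t / size_prob k t"
  unfolding down_rate_def using down_quotient_tendsto by (intro tendsto_Lim) auto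

lemma state_prob_eq_0:
  assumes "size_prob k t = 0" "A \<in> sets_of_size G k"
  shows "state_prob t A = 0"
  using assms sum_nonneg_eq_0_iff[of "sets_of_size G k" "state_prob t"] state_prob_nonneg by (simp add: size_prob_def)

text \<open>Where \<open>size_prob k t\<close> vanishes, so does each of its nonnegative summands
  and with them the flux; thus the equations also hold at times where the rate is a default
  value.\<close>

lemma up_rate_times: "0 \<le> t \<Longrightarrow> up_rate M G T k t * num_prob M G T k t = up_flow k t"
  using state_prob_eq_0[of k t] by (cases "size_prob k t = 0") (auto simp: up_rate_eq num_prob_eq up_flow_def)

lemma down_rate_times: "0 \<le> t \<Longrightarrow> down_rate M G T k t * num_prob M G T k t = down_flow k t"
  using state_prob_eq_0[of k t] by (cases "size_prob k t = 0") (auto simp: down_rate_eq num_prob_eq down_flow_def)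

lemma up_rate_formula:
  assumes "0 \<le> t"
  shows "up_rate M G T k t =
    (\<Sum>U\<in>sets_of_size G k. (total_act G U + total_self G (V - U)) * set_prob M G T t U)"
  unfolding up_rate_eq[OF assms] up_flow_def sum_divide_distrib
  by (intro sum.cong) (auto simp: set_prob_eq up_eq sets_of_size_subset)

lemma down_rate_formula:
  assumes "0 \<le> t"
  shows "down_rate M G T k t = (\<Sum>U\<in>sets_of_size G k. total_recov G U * set_prob M G T t U)"
  unfolding down_rate_eq[OF assms] down_flow_def sum_divide_distrib
  by (intro sum.cong) (auto simp: set_prob_eq down_eq sets_of_size_subset)

lemma num_prob_has_derivative:
  assumes "0 \<le> t"
  shows "(num_prob M G T k has_real_derivative
    (if k = 0 then 0 else up_rate M G T (k - 1) t * num_prob M G T (k - 1) t)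
    - up_rate M G T k t * num_prob M G T k t - down_rate M G T k t * num_prob M G T k t
    + down_rate M G T (Suc k) t * num_prob M G T (Suc k) t) (at t within {0..})"
proof -
  have "num_prob M G T k = size_prob k"
    using num_prob_eq by blast
  then show ?thesis
    using size_prob_has_derivative[OF assms, of k]
    unfolding up_rate_times[OF assms] down_rate_times[OF assms] by simp
qed

end

theorem theorem1:
  fixes M :: "'w measure" and G :: "'v network"
    and T :: "nat \<Rightarrow> 'v event \<Rightarrow> 'w \<Rightarrow> real" and K :: nat
    and q r \<rho> :: "nat \<Rightarrow> real \<Rightarrow> real"
  assumes "propagation_network G" and "card (nodes G) = K"
    and "propagation_clocks M G T"
  defines "q \<equiv> up_rate M G T" and "r \<equiv> down_rate M G T" and "\<rho> \<equiv> num_prob M G T"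
  shows
    "(\<forall>t\<ge>0. \<forall>k\<le>K. \<rho> k t > 0 \<longrightarrow>
        (up_quotient M G T k t \<longlongrightarrow> q k t) (at_right 0) \<and>
        (down_quotient M G T k t \<longlongrightarrow> r k t) (at_right 0) \<and>
        q k t = (\<Sum>U\<in>sets_of_size G k.
                   (total_act G U + total_self G (nodes G - U)) * set_prob M G T t U) \<and>
        r k t = (\<Sum>U\<in>sets_of_size G k. total_recov G U * set_prob M G T t U)) \<and>
     (\<forall>t\<ge>0.
        (\<rho> 0 has_real_derivative - q 0 t * \<rho> 0 t + r 1 t * \<rho> 1 t) (at t within {0..}) \<and>
        (\<forall>k. 0 < k \<and> k < K \<longrightarrow>
           (\<rho> k has_real_derivative
              q (k - 1) t * \<rho> (k - 1) t - (q k t + r k t) * \<rho> k t + r (k + 1) t * \<rho> (k + 1) t)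
             (at t within {0..})) \<and>
        (\<rho> K has_real_derivative q (K - 1) t * \<rho> (K - 1) t - r K t * \<rho> K t)
          (at t within {0..}))"
proof -
  interpret propagation_process G M T
    using assms by unfold_locales
  have deriv: "(\<rho> k has_real_derivative (if k = 0 then 0 else q (k - 1) t * \<rho> (k - 1) t)
      - q k t * \<rho> k t - r k t * \<rho> k t + r (Suc k) t * \<rho> (Suc k) t) (at t within {0..})"
    if "0 \<le> t" for k t
    unfolding q_def r_def \<rho>_def by (rule num_prob_has_derivative[OF that])
  \<comment> \<open>The fluxes across the ends of the range 0..K: nothing is left to activate in V,
    no set has K + 1 nodes, and the empty set has nothing to recover.\<close>
  have qK: "q K t * \<rho> K t = 0" and rK: "r (Suc K) t * \<rho> (Suc K) t = 0" and r0: "r 0 t * \<rho> 0 t = 0"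
    if "0 \<le> t" for t
    using that up_flow_nodes[of t] down_flow_0[of t] sets_of_size_empty[of "Suc K"] assms(2)
    by (simp_all add: q_def r_def \<rho>_def up_rate_times down_rate_times down_flow_def)
  have d0: "(\<rho> 0 has_real_derivative - q 0 t * \<rho> 0 t + r 1 t * \<rho> 1 t) (at t within {0..})"
    if "0 \<le> t" for t
    using deriv[OF that, of 0] r0[OF that] by simp
  have dk: "(\<rho> k has_real_derivative
      q (k - 1) t * \<rho> (k - 1) t - (q k t + r k t) * \<rho> k t + r (k + 1) t * \<rho> (k + 1) t)
      (at t within {0..})" if "0 \<le> t" "0 < k" for t k
    using deriv[OF that(1), of k] that(2) by (simp add: algebra_simps)
  have dK: "(\<rho> K has_real_derivative q (K - 1) t * \<rho> (K - 1) t - r K t * \<rho> K t)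
      (at t within {0..})" if "0 \<le> t" for t
  proof -
    \<comment> \<open>For K = 0, truncated subtraction turns K - 1 into 0, and the extra term
      \<open>q 0 t * \<rho> 0 t\<close> vanishes by \<open>qK\<close>.\<close>
    have eq: "(if K = 0 then 0 else q (K - 1) t * \<rho> (K - 1) t) - q K t * \<rho> K t - r K t * \<rho> K t +
      r (Suc K) t * \<rho> (Suc K) t = q (K - 1) t * \<rho> (K - 1) t - r K t * \<rho> K t"
      using qK[OF that] rK[OF that] by (cases "K = 0") auto
    show ?thesis
      using deriv[OF that, of K] unfolding eq .
  qed
  have quotients: "(up_quotient M G T k t \<longlongrightarrow> q k t) (at_right 0)"
    "(down_quotient M G T k t \<longlongrightarrow> r k t) (at_right 0)" if "0 \<le> t" for k t
    using up_quotient_tendsto[OF that] down_quotient_tendsto[OF that]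
    by (simp_all add: q_def r_def up_rate_eq[OF that] down_rate_eq[OF that])
  have formulas:
    "q k t = (\<Sum>U\<in>sets_of_size G k. (total_act G U + total_self G (nodes G - U)) * set_prob M G T t U)"
    "r k t = (\<Sum>U\<in>sets_of_size G k. total_recov G U * set_prob M G T t U)" if "0 \<le> t" for k t
    unfolding q_def r_def by (rule up_rate_formula[OF that] down_rate_formula[OF that])+
  show ?thesis
    by (intro conjI allI impI; (elim conjE)?; rule quotients formulas d0 dk dK; assumption)
qed

end
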